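(* Let $W_1,\dots,W_N$ be independent observations, let $\theta_0\in\mathbb{R}$, and let $\widehat{\mathrm{CI}}^{\mathtt{GHulC}}_{N,\alpha}$ be the GHulC confidence interval described in the context, built from $B$ batches with estimators $\widehat\theta_1,\dots,\widehat\theta_B$. Put $$\mathcal{E}_B:=\max_{1\le j\le B}\left(\tfrac12-\min\{\mathbb{P}(\widehat\theta_j\ge\theta_0),\ \mathbb{P}(\widehat\theta_j\le\theta_0)\}\right)_+ .$$ Then for every $\alpha\in(0,1)$ and every integer $B\ge\log_2(2/\alpha)$, $$\mathbb{P}\left(\theta_0\notin\widehat{\mathrm{CI}}^{\mathtt{GHulC}}_{N,\alpha}\right)\le\alpha\left(1+2B^2\mathcal{E}_B^2e^{2B\mathcal{E}_B}\right).$$ Hence, if $B=B_N$ is such that $B\mathcal{E}_B\to0$ as $N\to\infty$, then $\widehat{\mathrm{CI}}^{\mathtt{GHulC}}_{N,\alpha}$ is an asymptotically valid $1-\alpha$ confidence interval for $\theta_0$ (i.e. $\limsup_{N\to\infty}\mathbb{P}(\theta_0\notin\widehat{\mathrm{CI}}^{\mathtt{GHulC}}_{N,\alpha})\le\alpha$). Additionally, if $\mathbb{P}(\widehat\theta_j\le\theta_0)=\mathbb{P}(\widehat\theta_1\le\theta_0)$ and $\mathbb{P}(\widehat\theta_j=\theta_0)=0$ for all $j\in\{1,\dots,B\}$, then for every $\alpha\in(0,1)$ $$\mathbb{P}\left(\theta_0\notin\widehat{\mathrm{CI}}^{\mathtt{GHulC}}_{N,\alpha}\right)\ge\alpha.$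$
   Context: GHulC procedure. Inputs: independent observations $W_1,\dots,W_N$ (in a measurable space), level $\alpha$, an estimation procedure $\mathcal{A}$ mapping a finite data set to a real number, and a number of batches $B\ge\log_2(2/\alpha)$. (1) Split the data into $B$ disjoint sets $\{W_i:i\in S_j\}$, $1\le j\le B$ (independently of the data values). (2) Compute $\widehat\theta_j=\mathcal{A}(\{W_i:i\in S_j\})$; these are independent; let $\widehat\theta_{(1)}\le\dots\le\widehat\theta_{(B)}$ be their order statistics. (3) With $Y_B\sim\mathrm{Bin}(B,1/2)$, let $c_{B,\alpha}$ be the smallest integer $x$ with $\mathbb{P}(Y_B\ge\lfloor B/2\rfloor-x)\ge1-\alpha/2$. (4) Let $P(n,k)=\sum_{i=\lfloor n/2\rfloor-k}^{\lceil n/2\rceil+k}\binom{n}{i}2^{-n}$ (an empty sum is $0$) and $$\tau_\alpha=\frac{P(B,c_{B,\alpha})-(1-\alpha)}{P(B,c_{B,\alpha})-P(B,c_{B,\alpha}-1)}.$$ Draw $U\sim\mathrm{Uniform}(0,1)$ independent of the data, and set $c^*_{B,\alpha}=c_{B,\alpha}-1$ if $U\le\tau_\alpha$ and $c^*_{B,\alpha}=c_{B,\alpha}$ if $U>\tau_\alpha$. (5) Return $\widehat{\mathrm{CI}}^{\mathtt{GHulC}}_{N,\alpha}=\left[\widehat\theta_{(\lfloor B/2\rfloor-c^*_{B,\alpha})},\ \widehat\theta_{(\lceil B/2\rceil+c^*_{B,\alpha}+1)}\right]$ (the empty set if the lower index exceeds the upper index). Here $(x)_+=\max\{x,0\}$.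 *)

theory Defs
  imports "HOL-Probability.Probability"
begin

text \<open>
  A data set is passed to the estimation procedure as the list of its observations. Symmetry in the
  order of the observations is not required, so procedures on unordered data sets are included.
\<close>

definition estimation_procedure :: "'w measure \<Rightarrow> ('w list \<Rightarrow> real) \<Rightarrow> bool" where
  "estimation_procedure E \<A> \<longleftrightarrow>
     (\<forall>n. (\<lambda>x. \<A> (map x [0..<n])) \<in> borel_measurable (\<Pi>\<^sub>M i\<in>{..<n}. E))"

definition batch_estimator ::
  "('w list \<Rightarrow> real) \<Rightarrow> (nat \<Rightarrow> 'a \<Rightarrow> 'w) \<Rightarrow> (nat \<Rightarrow> nat set) \<Rightarrow> nat \<Rightarrow> 'a \<Rightarrow> real" where
  "batch_estimator \<A> W S j \<omega> = \<A> (map (\<lambda>i. W i \<omega>) (sorted_list_of_set (S j)))"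

text \<open>
  The \<open>k\<close>-th smallest of \<open>x 1, \<dots>, x B\<close>, meaningful for \<open>1 \<le> k \<le> B\<close>. If \<open>0 < \<alpha> < 1\<close> and
  \<open>B \<ge> log 2 (2 / \<alpha>)\<close>, both indices used in the confidence interval below lie in this range.
\<close>

definition order_statistic :: "nat \<Rightarrow> (nat \<Rightarrow> real) \<Rightarrow> int \<Rightarrow> real" where
  "order_statistic B x k = sort (map x [1..<Suc B]) ! nat (k - 1)"

definition ghulc_c :: "nat \<Rightarrow> real \<Rightarrow> int" where
  "ghulc_c B \<alpha> = (LEAST x.
     measure_pmf.prob (binomial_pmf B (1/2)) {y. int y \<ge> \<lfloor>real B / 2\<rfloor> - x} \<ge> 1 - \<alpha> / 2)"

definition central_binomial_prob :: "nat \<Rightarrow> int \<Rightarrow> real" where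
  "central_binomial_prob n k =
     (\<Sum>i \<in> {\<lfloor>real n / 2\<rfloor> - k..\<lceil>real n / 2\<rceil> + k}.
        (if i < 0 then 0 else real (n choose nat i) / 2 ^ n))"

definition ghulc_tau :: "nat \<Rightarrow> real \<Rightarrow> real" where
  "ghulc_tau B \<alpha> =
     (central_binomial_prob B (ghulc_c B \<alpha>) - (1 - \<alpha>)) /
     (central_binomial_prob B (ghulc_c B \<alpha>) - central_binomial_prob B (ghulc_c B \<alpha> - 1))"

definition ghulc_c_star :: "nat \<Rightarrow> real \<Rightarrow> real \<Rightarrow> int" where
  "ghulc_c_star B \<alpha> u = (if u \<le> ghulc_tau B \<alpha> then ghulc_c B \<alpha> - 1 else ghulc_c B \<alpha>)"

text \<open>
  When \<open>ghulc_c_star\<close> is \<open>-1\<close> and \<open>B\<close> is even, the lower index exceeds the upper one. The interval is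
  then empty by convention, even if the two order statistics coincide.
\<close>

definition ghulc_ci ::
  "('w list \<Rightarrow> real) \<Rightarrow> (nat \<Rightarrow> 'a \<Rightarrow> 'w) \<Rightarrow> (nat \<Rightarrow> nat set) \<Rightarrow> nat \<Rightarrow> ('a \<Rightarrow> real) \<Rightarrow> real
     \<Rightarrow> 'a \<Rightarrow> real set" where
  "ghulc_ci \<A> W S B U \<alpha> \<omega> =
     (let c = ghulc_c_star B \<alpha> (U \<omega>);
          l = \<lfloor>real B / 2\<rfloor> - c;
          u = \<lceil>real B / 2\<rceil> + c + 1;
          \<theta> = (\<lambda>j. batch_estimator \<A> W S j \<omega>)
      in if l > u then {} else {order_statistic B \<theta> l..order_statistic B \<theta> u})"

definition ghulc_miscoverage ::
  "'a measure \<Rightarrow> ('w list \<Rightarrow> real) \<Rightarrow> (nat \<Rightarrow> 'a \<Rightarrow> 'w) \<Rightarrow> (nat \<Rightarrow> nat set) \<Rightarrow> nat \<Rightarrow> ('a \<Rightarrow> real)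
     \<Rightarrow> real \<Rightarrow> real \<Rightarrow> real" where
  "ghulc_miscoverage M \<A> W S B U \<alpha> \<theta>\<^sub>0 = \<P>(\<omega> in M. \<theta>\<^sub>0 \<notin> ghulc_ci \<A> W S B U \<alpha> \<omega>)"

definition max_median_bias ::
  "'a measure \<Rightarrow> ('w list \<Rightarrow> real) \<Rightarrow> (nat \<Rightarrow> 'a \<Rightarrow> 'w) \<Rightarrow> (nat \<Rightarrow> nat set) \<Rightarrow> nat \<Rightarrow> real \<Rightarrow> real" where
  "max_median_bias M \<A> W S B \<theta>\<^sub>0 =
     (MAX j\<in>{1..B}.
        max (1/2 - min \<P>(\<omega> in M. batch_estimator \<A> W S j \<omega> \<ge> \<theta>\<^sub>0)
                       \<P>(\<omega> in M. batch_estimator \<A> W S j \<omega> \<le> \<theta>\<^sub>0)) 0)"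

text \<open>
  The split is a fixed partition of the index set; a random split independent of \<open>(W, U)\<close> is covered
  by conditioning on it. Given only the marginal law of a random split, the batch estimators need not
  be independent. Independence of \<open>U\<close> and the data is stated through the generated events, because
  \<open>indep_var\<close> requires both variables to take values in the same type.
\<close>

locale ghulc_setup = prob_space M
  for M :: "'a measure" +
  fixes E :: "'w measure"
    and W :: "nat \<Rightarrow> 'a \<Rightarrow> 'w"
    and N :: nat
    and \<A> :: "'w list \<Rightarrow> real"
    and S :: "nat \<Rightarrow> nat set"
    and B :: nat
    and U :: "'a \<Rightarrow> real"
    and \<alpha> :: real
  assumes indep_observations: "indep_vars (\<lambda>_. E) W {1..N}"
    and procedure: "estimation_procedure E \<A>"
    and batches: "real B \<ge> log 2 (2 / \<alpha>)"
    and split_disjoint: "disjoint_family_on S {1..B}"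
    and split_union: "(\<Union>j\<in>{1..B}. S j) = {1..N}"
    and U_measurable: "random_variable borel U"
    and U_uniform: "distr M borel U = uniform_measure lborel {0<..<1}"
    and U_indep: "indep_set {U -` C \<inter> space M | C. C \<in> sets borel}
      {(\<lambda>\<omega>. \<lambda>i\<in>{1..N}. W i \<omega>) -` D \<inter> space M | D. D \<in> sets (\<Pi>\<^sub>M i\<in>{1..N}. E)}"

end

theory Submission
  imports Defs
begin

text \<open>
  Breaking ties \<open>\<theta>\<^sub>j = \<theta>\<^sub>0\<close> at random can only enlarge the miscoverage event, and the tie-breaking
  probabilities can be chosen such that each estimator falls below \<open>\<theta>\<^sub>0\<close> with a probability \<open>r j\<close> within
  \<open>\<E>\<close> of \<open>1/2\<close>. Miscoverage then means that the random set of batches below \<open>\<theta>\<^sub>0\<close> has a cardinality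
  in the tails, and this family of sets is closed under complement. Averaging the probability of a
  set with that of its complement therefore bounds it by \<open>cosh (2 B \<E>)\<close> times its probability
  \<open>2\<^sup>-\<^sup>B\<close> under fair coins, and \<open>cosh x \<le> 1 + x\<^sup>2 / 2 * exp x\<close>. If all \<open>r j\<close> coincide, the same average
  increases with the distance of the cardinality from \<open>B / 2\<close>, so that the tails are least likely under
  fair coins. The randomised choice of the index makes the fair-coin tail probability exactly \<open>\<alpha>\<close>.
\<close>

section \<open>Probabilities of random subsets\<close>

text \<open>The probability that a random subset of \<open>J\<close>, containing each
  \<open>j\<close> independently with probability \<open>r j\<close>, equals \<open>T\<close>. Being
  a polynomial in \<open>r\<close>, it can also be evaluated at random \<open>r\<close> and then
  averaged.\<close>

definition subset_weight :: "'i set \<Rightarrow> ('i \<Rightarrow> real) \<Rightarrow> 'i set \<Rightarrow> real" where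
  "subset_weight J r T = (\<Prod>j\<in>T. r j) * (\<Prod>j\<in>J - T. 1 - r j)"

lemma subset_weight_eq_prod:
  assumes "finite J" "T \<subseteq> J"
  shows "subset_weight J r T = (\<Prod>j\<in>J. if j \<in> T then r j else 1 - r j)"
  unfolding subset_weight_def using assms
  by (simp add: prod.If_cases Int_absorb1 Diff_eq)

lemma subset_weight_cong:
  assumes "T \<subseteq> J" and "\<And>j. j \<in> J \<Longrightarrow> r j = q j"
  shows "subset_weight J r T = subset_weight J q T"
  unfolding subset_weight_def using assms
  by (intro arg_cong2[where f = "(*)"] prod.cong) auto

text \<open>Expanding the product of the factors \<open>r j + (1 - r j) = 1\<close> yields one term
  per subset.\<close>

lemma sum_subset_weight:
  assumes "finite J"
  shows "(\<Sum>T\<in>Pow J. subset_weight J r T) = 1"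
  using prod_add[OF assms, of r "\<lambda>j. 1 - r j"] by (simp add: subset_weight_def)

lemma subset_weight_nonneg:
  assumes "T \<subseteq> J" and "\<And>j. j \<in> J \<Longrightarrow> 0 \<le> r j \<and> r j \<le> 1"
  shows "0 \<le> subset_weight J r T"
  unfolding subset_weight_def using assms by (intro mult_nonneg_nonneg prod_nonneg) auto

lemma subset_weight_complement:
  assumes "T \<subseteq> J"
  shows "subset_weight J r (J - T) = subset_weight J (\<lambda>j. 1 - r j) T"
  using assms by (simp add: subset_weight_def double_diff mult.commute)

lemma sum_Pow_complement:
  fixes f :: "'i set \<Rightarrow> 'b::comm_monoid_add"
  assumes "\<T> \<subseteq> Pow J" and "\<And>T. T \<in> \<T> \<Longrightarrow> J - T \<in> \<T>"
  shows "(\<Sum>T\<in>\<T>. f T) = (\<Sum>T\<in>\<T>. f (J - T))"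
proof (rule sum.reindex_bij_witness[where i = "\<lambda>T. J - T" and j = "\<lambda>T. J - T"])
qed (use assms in \<open>auto simp: double_diff\<close>)

text \<open>Complementation permutes the family and exchanges \<open>r\<close> with
  \<open>1 - r\<close>, so either weight may be summed, and hence their average.\<close>

lemma sum_subset_weight_symmetrize:
  assumes "\<T> \<subseteq> Pow J" and "\<And>T. T \<in> \<T> \<Longrightarrow> J - T \<in> \<T>"
  shows "(\<Sum>T\<in>\<T>. subset_weight J r T) =
    (\<Sum>T\<in>\<T>. (subset_weight J r T + subset_weight J (\<lambda>j. 1 - r j) T) / 2)"
proof -
  have "(\<Sum>T\<in>\<T>. subset_weight J r T) = (\<Sum>T\<in>\<T>. subset_weight J (\<lambda>j. 1 - r j) T)"
    using sum_Pow_complement[OF assms, of "subset_weight J r"] assms(1)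
    by (auto simp: subset_weight_complement intro!: sum.cong)
  then show ?thesis
    by (simp add: sum.distrib flip: sum_divide_distrib)
qed

section \<open>Elementary bounds on the hyperbolic cosine\<close>

lemma cosh_le_abs:
  fixes x y :: real
  assumes "\<bar>x\<bar> \<le> y"
  shows "cosh x \<le> cosh y"
proof -
  have "cosh \<bar>x\<bar> \<le> cosh y"
    using assms by (subst cosh_real_nonneg_le_iff) auto
  then show ?thesis
    by (simp add: abs_if split: if_splits)
qed

text \<open>With \<open>y = x / 2\<close>, the half-argument formula is
  \<open>cosh x = 1 + 2 * (sinh y)\<^sup>2\<close>, and
  \<open>sinh y = exp y * (1 - exp (- 2 * y)) / 2\<close> is at most
  \<open>y * exp y\<close>.\<close>

lemma cosh_le_quadratic_exp:
  fixes x :: real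
  assumes "0 \<le> x"
  shows "cosh x \<le> 1 + x\<^sup>2 / 2 * exp x"
proof -
  define y where "y = x / 2"
  have y: "0 \<le> y" "x = y + y"
    using assms by (auto simp: y_def)
  have "1 - exp (- 2 * y) \<le> 2 * y"
    using exp_ge_add_one_self[of "- 2 * y"] by simp
  then have "exp y * (1 - exp (- 2 * y)) \<le> exp y * (2 * y)"
    by (intro mult_left_mono) auto
  moreover have "exp y * exp (- 2 * y) = exp (- y)"
    by (simp flip: exp_add)
  ultimately have "sinh y \<le> y * exp y"
    by (simp add: sinh_field_def algebra_simps)
  then have "(sinh y)\<^sup>2 \<le> (y * exp y)\<^sup>2"
    using y by (intro power_mono) auto
  moreover have "cosh x = 1 + 2 * (sinh y)\<^sup>2"
    using cosh_square_eq[of y] unfolding y(2) cosh_add by (simp add: power2_eq_square)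
  moreover have "2 * (y * exp y)\<^sup>2 = x\<^sup>2 / 2 * exp x"
    by (simp add: y(2) power2_eq_square flip: exp_add)
  ultimately show ?thesis
    by linarith
qed

text \<open>
  Averaging a weight with the weight of the complementary set cancels the first-order effect of the
  deviations of \<open>r\<close> from \<open>1/2\<close>.
\<close>

lemma subset_weight_pair_le:
  assumes J: "finite J" "T \<subseteq> J" and e: "0 \<le> e" "e \<le> 1/2"
    and r: "\<And>j. j \<in> J \<Longrightarrow> \<bar>r j - 1/2\<bar> \<le> e"
  shows "(subset_weight J r T + subset_weight J (\<lambda>j. 1 - r j) T) / 2
    \<le> cosh (2 * real (card J) * e) / 2 ^ card J"
proof -
  \<comment> \<open>The sign makes the factor at \<open>j\<close> equal to
    \<open>(1 + d j) / 2\<close> for \<open>r\<close> and \<open>(1 - d j) / 2\<close> for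
    \<open>1 - r\<close>.\<close>
  define d where "d j = (if j \<in> T then 2 * r j - 1 else 1 - 2 * r j)" for j
  have d: "\<bar>d j\<bar> \<le> 2 * e" if "j \<in> J" for j
    using r[OF that] by (auto simp: d_def abs_if split: if_splits)
  \<comment> \<open>Used with \<open>c = d\<close> and \<open>c = - d\<close>; the average of the
    two bounds is a \<open>cosh\<close>. The condition \<open>\<bar>c j\<bar> \<le> 1\<close>, which
    \<open>e \<le> 1/2\<close> provides, keeps the factors nonnegative, so that the inequalities
    \<open>1 + c j \<le> exp (c j)\<close> can be multiplied.\<close>
  have bound: "subset_weight J q T \<le> exp (\<Sum>j\<in>J. c j) / 2 ^ card J"
    if "\<And>j. j \<in> J \<Longrightarrow> (if j \<in> T then q j else 1 - q j) = (1 + c j) / 2"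
      and "\<And>j. j \<in> J \<Longrightarrow> \<bar>c j\<bar> \<le> 1" for q c :: "_ \<Rightarrow> real"
  proof -
    have "subset_weight J q T = (\<Prod>j\<in>J. (1 + c j) / 2)"
      unfolding subset_weight_eq_prod[OF J] using that(1) by (intro prod.cong) auto
    also have "\<dots> \<le> (\<Prod>j\<in>J. exp (c j) / 2)"
    proof (intro prod_mono conjI)
      fix j assume "j \<in> J"
      then show "0 \<le> (1 + c j) / 2"
        using that(2)[of j] by auto
      show "(1 + c j) / 2 \<le> exp (c j) / 2"
        by (intro divide_right_mono exp_ge_add_one_self) simp
    qed
    finally show ?thesis
      using J by (simp add: prod_dividef exp_sum)
  qed
  have d1: "\<bar>d j\<bar> \<le> 1" if "j \<in> J" for j
    using d[OF that] e by linarith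
  have "subset_weight J r T \<le> exp (\<Sum>j\<in>J. d j) / 2 ^ card J"
    using d1 by (intro bound) (auto simp: d_def)
  moreover have "subset_weight J (\<lambda>j. 1 - r j) T \<le> exp (\<Sum>j\<in>J. - d j) / 2 ^ card J"
    using d1 by (intro bound) (auto simp: d_def)
  ultimately have "(subset_weight J r T + subset_weight J (\<lambda>j. 1 - r j) T) / 2
      \<le> cosh (\<Sum>j\<in>J. d j) / 2 ^ card J"
    by (simp add: cosh_field_def sum_negf add_divide_distrib)
  also have "\<dots> \<le> cosh (2 * real (card J) * e) / 2 ^ card J"
  proof (intro divide_right_mono cosh_le_abs)
    have "\<bar>\<Sum>j\<in>J. d j\<bar> \<le> (\<Sum>j\<in>J. 2 * e)"
      using d by (intro sum_abs[THEN order_trans] sum_mono)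
    then show "\<bar>\<Sum>j\<in>J. d j\<bar> \<le> 2 * real (card J) * e"
      by (simp add: mult_ac)
  qed auto
  finally show ?thesis .
qed

section \<open>Symmetric tails under fair and biased coins\<close>

definition in_tails :: "nat \<Rightarrow> int \<Rightarrow> nat \<Rightarrow> bool" where
  "in_tails n l k \<longleftrightarrow> int k < l \<or> int n - l < int k"

definition tail_prob :: "nat \<Rightarrow> int \<Rightarrow> real" where
  "tail_prob n l = measure_pmf.prob (binomial_pmf n (1/2)) {k. in_tails n l k}"

text \<open>The number of heads among fair coins indexed by \<open>J\<close> is the size of a
  uniformly random subset, which turns tail probabilities into counts of subsets.\<close>

lemma binomial_half_eq_pmf_of_set:
  assumes "finite J"
  shows "binomial_pmf (card J) (1/2) = map_pmf card (pmf_of_set (Pow J))"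
  using assms
  by (simp add: binomial_pmf_altdef'[of J "card J" "1/2" False] pmf.map_comp o_def
      flip: pmf_of_set_Pow_conv_bernoulli[of J False])

lemma tail_prob_eq_card:
  assumes "finite J"
  shows "tail_prob (card J) l = real (card {T \<in> Pow J. in_tails (card J) l (card T)}) / 2 ^ card J"
  using assms
  by (simp add: tail_prob_def binomial_half_eq_pmf_of_set measure_pmf_of_set card_Pow
      Pow_not_empty Int_def vimage_def)

text \<open>Complementation exchanges the two tails; this is the closure that
  \<open>sum_subset_weight_symmetrize\<close> asks for.\<close>

lemma in_tails_complement:
  assumes "finite J" "T \<subseteq> J"
  shows "in_tails (card J) l (card (J - T)) \<longleftrightarrow> in_tails (card J) l (card T)"
  using card_mono[OF assms] assms
  by (auto simp: in_tails_def card_Diff_subset finite_subset of_nat_diff)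

text \<open>After symmetrisation each tail set weighs at most
  \<open>cosh (2 * real (card J) * e)\<close> times its fair-coin weight. As \<open>cosh\<close> has
  no linear term, the error is quadratic in \<open>e\<close>.\<close>

lemma sum_tail_subset_weight_le:
  assumes J: "finite J" and e: "0 \<le> e" "e \<le> 1/2"
    and r: "\<And>j. j \<in> J \<Longrightarrow> \<bar>r j - 1/2\<bar> \<le> e"
  shows "(\<Sum>T | T \<in> Pow J \<and> in_tails (card J) l (card T). subset_weight J r T)
    \<le> tail_prob (card J) l * (1 + 2 * (real (card J))\<^sup>2 * e\<^sup>2 * exp (2 * real (card J) * e))"
proof -
  let ?\<T> = "{T \<in> Pow J. in_tails (card J) l (card T)}"
  let ?x = "2 * real (card J) * e"
  have "(\<Sum>T\<in>?\<T>. subset_weight J r T) =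
      (\<Sum>T\<in>?\<T>. (subset_weight J r T + subset_weight J (\<lambda>j. 1 - r j) T) / 2)"
    using J by (intro sum_subset_weight_symmetrize) (auto simp: in_tails_complement)
  also have "\<dots> \<le> (\<Sum>T\<in>?\<T>. cosh ?x / 2 ^ card J)"
    using assms by (intro sum_mono subset_weight_pair_le) auto
  also have "\<dots> = tail_prob (card J) l * cosh ?x"
    using J by (simp add: tail_prob_eq_card)
  also have "\<dots> \<le> tail_prob (card J) l * (1 + ?x\<^sup>2 / 2 * exp ?x)"
    using e by (intro mult_left_mono cosh_le_quadratic_exp) (auto simp: tail_prob_def)
  finally show ?thesis
    by (simp add: power_mult_distrib mult_ac)
qed

text \<open>The difference of the two sides is
  \<open>(x * y) ^ k * ((x ^ d - y ^ d) * (x ^ m - y ^ m))\<close> with \<open>d = l - k\<close> and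
  \<open>m = n - l - k\<close>, and the last two factors have the same sign.\<close>

lemma power_pair_antimono:
  fixes x y :: real
  assumes "0 \<le> x" "0 \<le> y" "k \<le> l" "2 * l \<le> n"
  shows "x ^ l * y ^ (n - l) + x ^ (n - l) * y ^ l \<le> x ^ k * y ^ (n - k) + x ^ (n - k) * y ^ k"
proof -
  define d m where "d = l - k" and "m = n - l - k"
  have l: "l = k + d" "n - l = k + m" "n - k = k + d + m"
    using assms by (auto simp: d_def m_def)
  have "0 \<le> (x ^ d - y ^ d) * (x ^ m - y ^ m)"
  proof (cases "x \<le> y")
    case True
    then show ?thesis
      using assms by (intro mult_nonpos_nonpos) (simp_all add: power_mono)
  next
    case False
    then show ?thesis
      using assms by (intro mult_nonneg_nonneg) (simp_all add: power_mono)
  qed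
  then have "0 \<le> (x * y) ^ k * ((x ^ d - y ^ d) * (x ^ m - y ^ m))"
    using assms by (intro mult_nonneg_nonneg[OF zero_le_power]) auto
  then show ?thesis
    unfolding l(2,3) by (simp add: l(1) power_add power_mult_distrib algebra_simps)
qed

text \<open>
  With equal success probabilities the symmetrised weight grows with the distance of the cardinality
  from the centre, so its average over the tails is at least its average over all subsets.
\<close>

lemma sum_tail_subset_weight_ge:
  assumes J: "finite J" and r: "0 \<le> r" "r \<le> 1"
  shows "tail_prob (card J) l
    \<le> (\<Sum>T | T \<in> Pow J \<and> in_tails (card J) l (card T). subset_weight J (\<lambda>_. r) T)"
proof -
  define n where "n = card J"
  define w where "w k = (r ^ k * (1 - r) ^ (n - k) + r ^ (n - k) * (1 - r) ^ k) / 2" for k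
  define \<T> where "\<T> = {T \<in> Pow J. in_tails n l (card T)}"
  define \<C> where "\<C> = Pow J - \<T>"
  have fin: "finite \<T>" "finite \<C>"
    using J by (auto simp: \<T>_def \<C>_def)
  have card_le: "card T \<le> n" if "T \<in> Pow J" for T
    using that J by (auto simp: n_def intro: card_mono)
  have pair: "(subset_weight J (\<lambda>_. r) T + subset_weight J (\<lambda>_. 1 - r) T) / 2 = w (card T)"
    if "T \<in> Pow J" for T
    using that J by (simp add: subset_weight_def w_def n_def card_Diff_subset finite_subset mult_ac)
  have sum_eq: "(\<Sum>T\<in>\<S>. subset_weight J (\<lambda>_. r) T) = (\<Sum>T\<in>\<S>. w (card T))"
    if "\<S> \<subseteq> Pow J" "\<And>T. T \<in> \<S> \<Longrightarrow> J - T \<in> \<S>" for \<S>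
  proof -
    have "(\<Sum>T\<in>\<S>. subset_weight J (\<lambda>_. r) T) =
        (\<Sum>T\<in>\<S>. (subset_weight J (\<lambda>_. r) T + subset_weight J (\<lambda>_. 1 - r) T) / 2)"
      using that by (rule sum_subset_weight_symmetrize)
    also have "\<dots> = (\<Sum>T\<in>\<S>. w (card T))"
      using that pair by (intro sum.cong) auto
    finally show ?thesis .
  qed
  have w_sym: "w (n - k) = w k" if "k \<le> n" for k
    using that by (simp add: w_def add.commute)
  have w_min: "w k = w (min k (n - k))" if "k \<le> n" for k
    using that w_sym[of k] by (simp add: min_def)
  \<comment> \<open>The size of the smaller of a set and its complement measures closeness to the
    centre: it is no larger for a tail set than for a central one. Passing to this smaller size by
    \<open>w_min\<close> also supplies the condition \<open>2 * l \<le> n\<close> of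
    \<open>power_pair_antimono\<close>.\<close>
  have mono: "w (card C) \<le> w (card T)" if "T \<in> \<T>" "C \<in> \<C>" for T C
  proof -
    let ?m = "\<lambda>T. min (card T) (n - card T)"
    have le: "card T \<le> n" "card C \<le> n"
      using that card_le by (auto simp: \<T>_def \<C>_def)
    have "?m T \<le> ?m C"
      using that le by (auto simp: \<T>_def \<C>_def in_tails_def min_def of_nat_diff)
    moreover have "2 * ?m C \<le> n"
      using le by auto
    ultimately have "w (?m C) \<le> w (?m T)"
      unfolding w_def using r by (intro divide_right_mono power_pair_antimono) auto
    then show ?thesis
      using w_min le by metis
  qed
  define s where "s = (\<Sum>T\<in>\<T>. w (card T))"
  have total: "s + (\<Sum>C\<in>\<C>. w (card C)) = 1"
  proof -
    have "s + (\<Sum>C\<in>\<C>. w (card C)) = (\<Sum>T\<in>Pow J. w (card T))"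
      unfolding s_def \<C>_def using J by (subst sum.subset_diff[of \<T> "Pow J"]) (auto simp: \<T>_def)
    also have "\<dots> = 1"
      using sum_eq[of "Pow J"] sum_subset_weight[OF J, of "\<lambda>_. r"] by auto
    finally show ?thesis .
  qed
  \<comment> \<open>Comparing every tail set with every central set and summing over all pairs gives
    \<open>card \<T> * (1 - s) \<le> card \<C> * s\<close>, so the tail mass \<open>s\<close> is at
    least the proportion of tail sets.\<close>
  have "real (card \<T>) * (\<Sum>C\<in>\<C>. w (card C)) = (\<Sum>T\<in>\<T>. \<Sum>C\<in>\<C>. w (card C))"
    by simp
  also have "\<dots> \<le> (\<Sum>T\<in>\<T>. \<Sum>C\<in>\<C>. w (card T))"
    using mono by (intro sum_mono) auto
  also have "\<dots> = real (card \<C>) * s"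
    by (simp add: s_def sum_distrib_left)
  finally have "real (card \<T>) * (\<Sum>C\<in>\<C>. w (card C)) \<le> real (card \<C>) * s" .
  moreover have "(\<Sum>C\<in>\<C>. w (card C)) = 1 - s"
    using total by simp
  ultimately have "real (card \<T>) \<le> s * (real (card \<T>) + real (card \<C>))"
    by (simp add: algebra_simps)
  also have "real (card \<T>) + real (card \<C>) = 2 ^ n"
  proof -
    have "card \<T> + card \<C> = card (Pow J)"
      using J fin by (subst card_Un_disjoint[symmetric]) (auto simp: \<C>_def \<T>_def intro: arg_cong[where f = card])
    then show ?thesis
      using J by (simp add: card_Pow n_def flip: of_nat_add)
  qed
  finally have "real (card \<T>) / 2 ^ n \<le> s"
    by (simp add: field_simps)
  moreover have "s = (\<Sum>T\<in>\<T>. subset_weight J (\<lambda>_. r) T)"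
    unfolding s_def using J by (intro sum_eq[symmetric]) (auto simp: \<T>_def n_def in_tails_complement)
  ultimately show ?thesis
    using J by (simp add: tail_prob_eq_card \<T>_def n_def)
qed

section \<open>Tie-breaking\<close>

text \<open>
  The first disjunct covers indices \<open>l\<close> that exceed the upper index \<open>card J + 1 - l\<close>, where the interval
  is empty by convention.
\<close>

definition misses :: "'i set \<Rightarrow> int \<Rightarrow> real \<Rightarrow> ('i \<Rightarrow> real) \<Rightarrow> bool" where
  "misses J l \<theta> x \<longleftrightarrow> int (card J) + 1 < 2 * l
     \<or> int (card {j \<in> J. x j \<le> \<theta>}) < l \<or> int (card J) - l < int (card {j \<in> J. x j < \<theta>})"

lemma misses_cong:
  assumes "\<And>j. j \<in> J \<Longrightarrow> x j = y j"
  shows "misses J l \<theta> x \<longleftrightarrow> misses J l \<theta> y"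
proof -
  have "{j \<in> J. x j \<le> \<theta>} = {j \<in> J. y j \<le> \<theta>}" "{j \<in> J. x j < \<theta>} = {j \<in> J. y j < \<theta>}"
    using assms by auto
  then show ?thesis
    by (simp only: misses_def)
qed

text \<open>
  The conditional probability that an estimate equal to \<open>y\<close> is counted as lying below \<open>\<theta>\<close>, when ties are
  broken downwards with probability \<open>t\<close>.
\<close>

definition tie_break :: "real \<Rightarrow> real \<Rightarrow> real \<Rightarrow> real" where
  "tie_break \<theta> t y = (if y < \<theta> then 1 else if y = \<theta> then t else 0)"

lemma measurable_misses:
  assumes J: "finite J" and X[measurable]: "\<And>j. j \<in> J \<Longrightarrow> X j \<in> borel_measurable N"
  shows "Measurable.pred N (\<lambda>\<omega>. misses J l \<theta> (\<lambda>j. X j \<omega>))"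
proof -
  \<comment> \<open>As real sums of indicators the counts become visibly measurable
    functions.\<close>
  have card_eq: "real (card {j \<in> J. P j}) = (\<Sum>j\<in>J. if P j then 1 else 0)" for P
    using J by (simp add: sum.If_cases Int_def)
  have card_less: "int (card {j \<in> J. P j}) < m \<longleftrightarrow> (\<Sum>j\<in>J. if P j then 1 else 0) < real_of_int m"
    "m < int (card {j \<in> J. P j}) \<longleftrightarrow> real_of_int m < (\<Sum>j\<in>J. if P j then 1 else 0)" for P m
    unfolding card_eq[symmetric] by linarith+
  show ?thesis
    unfolding misses_def card_less by measurable
qed

text \<open>An index with \<open>x j < \<theta>\<close> outside \<open>T\<close>, or with
  \<open>x j > \<theta>\<close> inside \<open>T\<close>, contributes a zero factor.\<close>

lemma tie_break_weight_nonzero: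
  assumes "finite J" "T \<subseteq> J" "subset_weight J (\<lambda>j. tie_break \<theta> (t j) (x j)) T \<noteq> 0"
  shows "{j \<in> J. x j < \<theta>} \<subseteq> T" "T \<subseteq> {j \<in> J. x j \<le> \<theta>}"
  using assms by (auto simp: subset_weight_eq_prod tie_break_def split: if_splits)

text \<open>Every \<open>T\<close> of nonzero weight lies between the strict and the weak lower set,
  so on a miss its size is in the tails however ties are broken, and the tails carry the whole
  mass.\<close>

lemma misses_imp_tail_sum:
  assumes J: "finite J" and "misses J l \<theta> x"
  shows "(\<Sum>T | T \<in> Pow J \<and> in_tails (card J) l (card T).
    subset_weight J (\<lambda>j. tie_break \<theta> (t j) (x j)) T) = 1"
proof -
  let ?w = "subset_weight J (\<lambda>j. tie_break \<theta> (t j) (x j))"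
  have "?w T = 0" if T: "T \<subseteq> J" "\<not> in_tails (card J) l (card T)" for T
  proof (rule ccontr)
    assume "?w T \<noteq> 0"
    note sub = tie_break_weight_nonzero[OF J T(1) this]
    have "card {j \<in> J. x j < \<theta>} \<le> card T" "card T \<le> card {j \<in> J. x j \<le> \<theta>}"
      using sub J T by (auto intro!: card_mono intro: finite_subset)
    then show False
      using T(2) assms(2) by (auto simp: in_tails_def misses_def)
  qed
  then have "(\<Sum>T | T \<in> Pow J \<and> in_tails (card J) l (card T). ?w T) = (\<Sum>T\<in>Pow J. ?w T)"
    using J by (intro sum.mono_neutral_left) auto
  then show ?thesis
    using sum_subset_weight[OF J] by simp
qed

text \<open>Without ties the strict and the weak lower set coincide and are the only possible
  \<open>T\<close> of nonzero weight; without a miss this set is central.\<close>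

lemma tail_sum_le_misses:
  assumes J: "finite J" and ties: "\<And>j. j \<in> J \<Longrightarrow> x j \<noteq> \<theta>"
  shows "(\<Sum>T | T \<in> Pow J \<and> in_tails (card J) l (card T).
    subset_weight J (\<lambda>j. tie_break \<theta> 0 (x j)) T) \<le> of_bool (misses J l \<theta> x)"
proof -
  let ?w = "subset_weight J (\<lambda>j. tie_break \<theta> 0 (x j))"
  have nonneg: "0 \<le> ?w T" if "T \<subseteq> J" for T
    using that by (rule subset_weight_nonneg) (auto simp: tie_break_def)
  show ?thesis
  proof (cases "misses J l \<theta> x")
    case True
    have "(\<Sum>T | T \<in> Pow J \<and> in_tails (card J) l (card T). ?w T) \<le> (\<Sum>T\<in>Pow J. ?w T)"
      using J nonneg by (intro sum_mono2) auto
    then show ?thesis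
      using True sum_subset_weight[OF J] by simp
  next
    case False
    have "?w T = 0" if T: "T \<subseteq> J" "in_tails (card J) l (card T)" for T
    proof (rule ccontr)
      assume "?w T \<noteq> 0"
      note sub = tie_break_weight_nonzero[OF J T(1) this]
      have "{j \<in> J. x j < \<theta>} = {j \<in> J. x j \<le> \<theta>}"
        using ties by (auto simp: less_le)
      then have "{j \<in> J. x j < \<theta>} = T" "{j \<in> J. x j \<le> \<theta>} = T"
        using sub by auto
      then show False
        using T(2) False by (auto simp: in_tails_def misses_def)
    qed
    then show ?thesis
      using False by (simp add: sum.neutral)
  qed
qed

section \<open>Averaging over independent estimators\<close>

context prob_space
begin

text \<open>The weight is a product of independent factors \<open>Y j\<close> or
  \<open>1 - Y j\<close>, so the expectation passes to each factor.\<close>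

lemma expectation_subset_weight:
  fixes Y :: "'i \<Rightarrow> 'a \<Rightarrow> real"
  assumes J: "finite J" "T \<subseteq> J" and indep: "indep_vars (\<lambda>_. borel) Y J"
    and bounds: "\<And>j \<omega>. j \<in> J \<Longrightarrow> 0 \<le> Y j \<omega> \<and> Y j \<omega> \<le> 1"
  shows "integrable M (\<lambda>\<omega>. subset_weight J (\<lambda>j. Y j \<omega>) T)"
    and "expectation (\<lambda>\<omega>. subset_weight J (\<lambda>j. Y j \<omega>) T) =
      subset_weight J (\<lambda>j. expectation (Y j)) T"
proof -
  define Z where "Z j \<omega> = (if j \<in> T then Y j \<omega> else 1 - Y j \<omega>)" for j \<omega>
  have Y: "Y j \<in> borel_measurable M" if "j \<in> J" for j
    using indep that by (auto simp: indep_vars_def)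
  have intY: "integrable M (Y j)" if "j \<in> J" for j
    using bounds[OF that] by (intro integrable_const_bound[where B = 1] Y that) auto
  have intZ: "integrable M (Z j)" if "j \<in> J" for j
    using intY[OF that] by (cases "j \<in> T") (simp_all add: Z_def[abs_def])
  have "indep_vars (\<lambda>_. borel) (\<lambda>j \<omega>. (\<lambda>y. if j \<in> T then y else 1 - y) (Y j \<omega>)) J"
    using indep by (rule indep_vars_compose2) simp
  then have indepZ: "indep_vars (\<lambda>_. borel) Z J"
    by (simp add: Z_def[abs_def])
  have eq: "(\<lambda>\<omega>. subset_weight J (\<lambda>j. Y j \<omega>) T) = (\<lambda>\<omega>. \<Prod>j\<in>J. Z j \<omega>)"
    using J by (simp add: subset_weight_eq_prod Z_def)
  show "integrable M (\<lambda>\<omega>. subset_weight J (\<lambda>j. Y j \<omega>) T)"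
    unfolding eq using J(1) indepZ intZ by (rule indep_vars_integrable)
  have "expectation (\<lambda>\<omega>. \<Prod>j\<in>J. Z j \<omega>) = (\<Prod>j\<in>J. expectation (Z j))"
    using J(1) indepZ intZ by (rule indep_vars_lebesgue_integral)
  also have "\<dots> = (\<Prod>j\<in>J. if j \<in> T then expectation (Y j) else 1 - expectation (Y j))"
    using intY by (intro prod.cong) (auto simp: Z_def[abs_def] prob_space)
  finally show "expectation (\<lambda>\<omega>. subset_weight J (\<lambda>j. Y j \<omega>) T) =
      subset_weight J (\<lambda>j. expectation (Y j)) T"
    by (simp only: fun_cong[OF eq] subset_weight_eq_prod[OF J])
qed

lemma expectation_tie_break:
  assumes [measurable]: "X \<in> borel_measurable M"
  shows "expectation (\<lambda>\<omega>. tie_break \<theta> t (X \<omega>)) =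
    \<P>(\<omega> in M. X \<omega> < \<theta>) + t * \<P>(\<omega> in M. X \<omega> = \<theta>)"
proof -
  have "(\<lambda>\<omega>. tie_break \<theta> t (X \<omega>)) =
      (\<lambda>\<omega>. indicator {\<omega>. X \<omega> < \<theta>} \<omega> + t * indicator {\<omega>. X \<omega> = \<theta>} \<omega>)"
    by (auto simp: tie_break_def fun_eq_iff)
  moreover have "expectation (\<lambda>\<omega>. indicator {\<omega>. P \<omega>} \<omega>) = \<P>(\<omega> in M. P \<omega>)"
    "integrable M (\<lambda>\<omega>. indicator {\<omega>. P \<omega>} \<omega> :: real)"
    if [measurable]: "Measurable.pred M P" for P
  proof -
    have *: "expectation (\<lambda>\<omega>. indicator {\<omega>. P \<omega>} \<omega>) = expectation (indicator {\<omega> \<in> space M. P \<omega>})"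
      by (intro Bochner_Integration.integral_cong) (auto simp: indicator_def)
    show "expectation (\<lambda>\<omega>. indicator {\<omega>. P \<omega>} \<omega>) = \<P>(\<omega> in M. P \<omega>)"
      unfolding * by simp
    show "integrable M (\<lambda>\<omega>. indicator {\<omega>. P \<omega>} \<omega> :: real)"
      by (intro integrable_const_bound[where B = 1]) (auto simp: indicator_def)
  qed
  ultimately show ?thesis
    by simp
qed

text \<open>By linearity, averaging the conditional tail mass over the estimates gives the tail mass
  for independent coins; \<open>r j\<close> is the overall probability that estimate
  \<open>j\<close> counts as below \<open>\<theta>\<close>.\<close>

lemma expectation_tail_sum:
  fixes \<theta> :: real
  assumes J: "finite J" and indep: "indep_vars (\<lambda>_. borel) X J"
    and t: "\<And>j. j \<in> J \<Longrightarrow> 0 \<le> t j \<and> t j \<le> 1"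
  defines "r \<equiv> \<lambda>j. \<P>(\<omega> in M. X j \<omega> < \<theta>) + t j * \<P>(\<omega> in M. X j \<omega> = \<theta>)"
  shows "integrable M (\<lambda>\<omega>. \<Sum>T | T \<in> Pow J \<and> in_tails (card J) l (card T).
      subset_weight J (\<lambda>j. tie_break \<theta> (t j) (X j \<omega>)) T)"
    and "expectation (\<lambda>\<omega>. \<Sum>T | T \<in> Pow J \<and> in_tails (card J) l (card T).
      subset_weight J (\<lambda>j. tie_break \<theta> (t j) (X j \<omega>)) T) =
      (\<Sum>T | T \<in> Pow J \<and> in_tails (card J) l (card T). subset_weight J r T)"
proof -
  have bounds: "0 \<le> tie_break \<theta> (t j) y \<and> tie_break \<theta> (t j) y \<le> 1" if "j \<in> J" for j y
    using t[OF that] by (simp add: tie_break_def)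
  have "indep_vars (\<lambda>_. borel) (\<lambda>j \<omega>. tie_break \<theta> (t j) (X j \<omega>)) J"
    using indep by (rule indep_vars_compose2) (simp add: tie_break_def[abs_def])
  note ex = expectation_subset_weight[OF J _ this bounds]
  have X: "X j \<in> borel_measurable M" if "j \<in> J" for j
    using indep that by (simp add: indep_vars_def)
  show "integrable M (\<lambda>\<omega>. \<Sum>T | T \<in> Pow J \<and> in_tails (card J) l (card T).
      subset_weight J (\<lambda>j. tie_break \<theta> (t j) (X j \<omega>)) T)"
    by (rule Bochner_Integration.integrable_sum) (rule ex(1), simp_all)
  have weight: "subset_weight J (\<lambda>j. expectation (\<lambda>\<omega>. tie_break \<theta> (t j) (X j \<omega>))) T = subset_weight J r T"
    if "T \<subseteq> J" for T
    using that by (rule subset_weight_cong) (simp add: r_def expectation_tie_break X)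
  have "expectation (\<lambda>\<omega>. \<Sum>T | T \<in> Pow J \<and> in_tails (card J) l (card T).
      subset_weight J (\<lambda>j. tie_break \<theta> (t j) (X j \<omega>)) T) =
      (\<Sum>T | T \<in> Pow J \<and> in_tails (card J) l (card T).
        expectation (\<lambda>\<omega>. subset_weight J (\<lambda>j. tie_break \<theta> (t j) (X j \<omega>)) T))"
    by (rule Bochner_Integration.integral_sum) (rule ex(1), simp_all)
  also have "\<dots> = (\<Sum>T | T \<in> Pow J \<and> in_tails (card J) l (card T). subset_weight J r T)"
  proof (rule sum.cong[OF refl])
    fix T assume "T \<in> {T. T \<in> Pow J \<and> in_tails (card J) l (card T)}"
    then have "T \<subseteq> J"
      by simp
    then show "expectation (\<lambda>\<omega>. subset_weight J (\<lambda>j. tie_break \<theta> (t j) (X j \<omega>)) T) = subset_weight J r T"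
      using ex(2)[of T] weight[of T] by simp
  qed
  finally show "expectation (\<lambda>\<omega>. \<Sum>T | T \<in> Pow J \<and> in_tails (card J) l (card T).
      subset_weight J (\<lambda>j. tie_break \<theta> (t j) (X j \<omega>)) T) =
      (\<Sum>T | T \<in> Pow J \<and> in_tails (card J) l (card T). subset_weight J r T)" .
qed

text \<open>The indicator of a miss is dominated by the conditional tail mass for suitable
  \<open>t\<close>; taking expectations leaves the tail mass for coins within \<open>e\<close> of
  fair.\<close>

lemma prob_misses_le:
  assumes J: "finite J" and indep: "indep_vars (\<lambda>_. borel) X J" and e: "0 \<le> e" "e \<le> 1/2"
    and le: "\<And>j. j \<in> J \<Longrightarrow> 1/2 - e \<le> \<P>(\<omega> in M. X j \<omega> \<le> \<theta>)"
    and ge: "\<And>j. j \<in> J \<Longrightarrow> 1/2 - e \<le> \<P>(\<omega> in M. \<theta> \<le> X j \<omega>)"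
  shows "\<P>(\<omega> in M. misses J l \<theta> (\<lambda>j. X j \<omega>))
    \<le> tail_prob (card J) l * (1 + 2 * (real (card J))\<^sup>2 * e\<^sup>2 * exp (2 * real (card J) * e))"
proof -
  have X[measurable]: "X j \<in> borel_measurable M" if "j \<in> J" for j
    using indep that by (auto simp: indep_vars_def)
  define r where "r t j = \<P>(\<omega> in M. X j \<omega> < \<theta>) + t * \<P>(\<omega> in M. X j \<omega> = \<theta>)" for t j
  \<comment> \<open>As \<open>t\<close> runs from 0 to 1, \<open>r t j\<close> runs from
    \<open>?L\<close> to \<open>?L + ?Q\<close>. If \<open>?L\<close> is already at least
    \<open>1/2 - e\<close>, then \<open>t = 0\<close> works; otherwise \<open>t\<close> is solved
    for so that \<open>r t j\<close> is exactly \<open>1/2 - e\<close>.\<close>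
  have "\<exists>t. 0 \<le> t \<and> t \<le> 1 \<and> \<bar>r t j - 1/2\<bar> \<le> e" if j: "j \<in> J" for j
  proof -
    let ?L = "\<P>(\<omega> in M. X j \<omega> < \<theta>)" and ?Q = "\<P>(\<omega> in M. X j \<omega> = \<theta>)"
    note [measurable] = X[OF j]
    have "\<P>(\<omega> in M. X j \<omega> \<le> \<theta>) = ?L + ?Q"
      by (subst finite_measure_Union[symmetric]) (auto intro: arg_cong[where f = prob])
    then have lower: "1/2 - e \<le> ?L + ?Q"
      using le[OF j] by simp
    have "\<P>(\<omega> in M. \<theta> \<le> X j \<omega>) = 1 - ?L"
      by (subst prob_neg[symmetric]) (auto simp: not_less)
    then have upper: "?L \<le> 1/2 + e"
      using ge[OF j] by simp
    show ?thesis
    proof (cases "1/2 - e \<le> ?L")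
      case True
      then show ?thesis
        using upper by (intro exI[of _ 0]) (auto simp: r_def abs_le_iff)
    next
      case False
      then have "0 < ?Q"
        using lower by linarith
      then have "r ((1/2 - e - ?L) / ?Q) j = 1/2 - e" "(1/2 - e - ?L) / ?Q \<le> 1"
          "0 \<le> (1/2 - e - ?L) / ?Q"
        using False lower by (simp_all add: r_def divide_le_eq)
      then show ?thesis
        using e by (intro exI[of _ "(1/2 - e - ?L) / ?Q"]) simp
    qed
  qed
  then obtain t where t: "0 \<le> t j \<and> t j \<le> 1" "\<bar>r (t j) j - 1/2\<bar> \<le> e" if "j \<in> J" for j
    by metis
  note ex = expectation_tail_sum[OF J indep t(1), where \<theta> = \<theta> and l = l]
  have [measurable]: "Measurable.pred M (\<lambda>\<omega>. misses J l \<theta> (\<lambda>j. X j \<omega>))"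
    using J X by (rule measurable_misses)
  have nonneg: "0 \<le> subset_weight J (\<lambda>j. tie_break \<theta> (t j) (X j \<omega>)) T" if "T \<subseteq> J" for T \<omega>
    using that t(1) by (intro subset_weight_nonneg) (auto simp: tie_break_def)
  have "\<P>(\<omega> in M. misses J l \<theta> (\<lambda>j. X j \<omega>)) =
      expectation (indicator {\<omega> \<in> space M. misses J l \<theta> (\<lambda>j. X j \<omega>)})"
    by simp
  also have "\<dots> \<le> expectation (\<lambda>\<omega>. \<Sum>T | T \<in> Pow J \<and> in_tails (card J) l (card T).
      subset_weight J (\<lambda>j. tie_break \<theta> (t j) (X j \<omega>)) T)"
  proof (rule integral_mono)
    show "integrable M (indicator {\<omega> \<in> space M. misses J l \<theta> (\<lambda>j. X j \<omega>)} :: 'a \<Rightarrow> real)"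
      by (simp add: integrable_indicator_iff emeasure_eq_measure)
    show "integrable M (\<lambda>\<omega>. \<Sum>T | T \<in> Pow J \<and> in_tails (card J) l (card T).
        subset_weight J (\<lambda>j. tie_break \<theta> (t j) (X j \<omega>)) T)"
      by (rule ex(1))
    show "indicator {\<omega> \<in> space M. misses J l \<theta> (\<lambda>j. X j \<omega>)} \<omega>
      \<le> (\<Sum>T | T \<in> Pow J \<and> in_tails (card J) l (card T).
        subset_weight J (\<lambda>j. tie_break \<theta> (t j) (X j \<omega>)) T)" if "\<omega> \<in> space M" for \<omega>
      using misses_imp_tail_sum[OF J, of l \<theta> "\<lambda>j. X j \<omega>" t] nonneg
      by (auto simp: indicator_def intro!: sum_nonneg)
  qed
  also have "\<dots> = (\<Sum>T | T \<in> Pow J \<and> in_tails (card J) l (card T). subset_weight J (\<lambda>j. r (t j) j) T)"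
    unfolding r_def by (rule ex(2))
  also have "\<dots> \<le> tail_prob (card J) l * (1 + 2 * (real (card J))\<^sup>2 * e\<^sup>2 * exp (2 * real (card J) * e))"
    using J e t(2) by (rule sum_tail_subset_weight_le)
  finally show ?thesis .
qed

text \<open>Ties have probability zero, so \<open>t = 0\<close> serves: all coins then have the same
  bias \<open>p\<close>, and almost surely the conditional tail mass is at most the indicator of a
  miss.\<close>

lemma prob_misses_ge:
  assumes J: "finite J" and indep: "indep_vars (\<lambda>_. borel) X J"
    and p: "\<And>j. j \<in> J \<Longrightarrow> \<P>(\<omega> in M. X j \<omega> \<le> \<theta>) = p" "0 \<le> p" "p \<le> 1"
    and ties: "\<And>j. j \<in> J \<Longrightarrow> \<P>(\<omega> in M. X j \<omega> = \<theta>) = 0"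
  shows "tail_prob (card J) l \<le> \<P>(\<omega> in M. misses J l \<theta> (\<lambda>j. X j \<omega>))"
proof -
  have X[measurable]: "X j \<in> borel_measurable M" if "j \<in> J" for j
    using indep that by (auto simp: indep_vars_def)
  have [measurable]: "Measurable.pred M (\<lambda>\<omega>. misses J l \<theta> (\<lambda>j. X j \<omega>))"
    using J X by (rule measurable_misses)
  have AE_ties: "AE \<omega> in M. \<forall>j\<in>J. X j \<omega> \<noteq> \<theta>"
  proof (rule AE_finite_allI[OF J])
    fix j assume j: "j \<in> J"
    note [measurable] = X[OF j]
    show "AE \<omega> in M. X j \<omega> \<noteq> \<theta>"
      using ties[OF j] by (subst (asm) prob_eq_0) auto
  qed
  have less: "\<P>(\<omega> in M. X j \<omega> < \<theta>) = p" if j: "j \<in> J" for j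
  proof -
    note [measurable] = X[OF j]
    have "\<P>(\<omega> in M. X j \<omega> < \<theta>) = \<P>(\<omega> in M. X j \<omega> \<le> \<theta>)"
    proof (rule prob_eq_AE)
      show "AE \<omega> in M. X j \<omega> < \<theta> \<longleftrightarrow> X j \<omega> \<le> \<theta>"
        using AE_ties by eventually_elim (use j in \<open>auto simp: less_le\<close>)
    qed auto
    then show ?thesis
      using p(1)[OF j] by simp
  qed
  have "\<And>j. j \<in> J \<Longrightarrow> (0::real) \<le> 0 \<and> (0::real) \<le> 1"
    by simp
  note ex = expectation_tail_sum[OF J indep this, where \<theta> = \<theta> and l = l]
  have "tail_prob (card J) l
      \<le> (\<Sum>T | T \<in> Pow J \<and> in_tails (card J) l (card T). subset_weight J (\<lambda>_. p) T)"
    using J p(2,3) by (rule sum_tail_subset_weight_ge)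
  also have "\<dots> = (\<Sum>T | T \<in> Pow J \<and> in_tails (card J) l (card T).
      subset_weight J (\<lambda>j. \<P>(\<omega> in M. X j \<omega> < \<theta>) + 0 * \<P>(\<omega> in M. X j \<omega> = \<theta>)) T)"
    by (intro sum.cong refl subset_weight_cong) (simp_all add: less)
  also have "\<dots> = expectation (\<lambda>\<omega>. \<Sum>T | T \<in> Pow J \<and> in_tails (card J) l (card T).
      subset_weight J (\<lambda>j. tie_break \<theta> 0 (X j \<omega>)) T)"
    by (rule ex(2)[symmetric])
  also have "\<dots> \<le> expectation (indicator {\<omega> \<in> space M. misses J l \<theta> (\<lambda>j. X j \<omega>)})"
  proof (rule integral_mono_AE)
    show "integrable M (indicator {\<omega> \<in> space M. misses J l \<theta> (\<lambda>j. X j \<omega>)} :: 'a \<Rightarrow> real)"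
      by (simp add: integrable_indicator_iff emeasure_eq_measure)
    show "integrable M (\<lambda>\<omega>. \<Sum>T | T \<in> Pow J \<and> in_tails (card J) l (card T).
        subset_weight J (\<lambda>j. tie_break \<theta> 0 (X j \<omega>)) T)"
      by (rule ex(1))
    show "AE \<omega> in M. (\<Sum>T | T \<in> Pow J \<and> in_tails (card J) l (card T).
        subset_weight J (\<lambda>j. tie_break \<theta> 0 (X j \<omega>)) T)
        \<le> indicator {\<omega> \<in> space M. misses J l \<theta> (\<lambda>j. X j \<omega>)} \<omega>"
      using AE_ties AE_space
    proof eventually_elim
      case (elim \<omega>)
      then show ?case
        using tail_sum_le_misses[OF J, of "\<lambda>j. X j \<omega>" \<theta> l] by (simp add: indicator_def)
    qed
  qed
  also have "\<dots> = \<P>(\<omega> in M. misses J l \<theta> (\<lambda>j. X j \<omega>))"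
    by simp
  finally show ?thesis .
qed

end

section \<open>Order statistics and binomial tails\<close>

text \<open>For downward closed \<open>P\<close>, the entries satisfying it form an initial segment
  of the sorted list.\<close>

lemma sorted_nth_iff_filter:
  fixes ys :: "real list"
  assumes "sorted ys" "i < length ys" and down: "\<And>x y. x \<le> y \<Longrightarrow> P y \<Longrightarrow> P x"
  shows "P (ys ! i) \<longleftrightarrow> i < length (filter P ys)"
  using assms(1,2)
proof (induction ys arbitrary: i)
  case (Cons y ys)
  show ?case
  proof (cases "P y")
    case True
    then show ?thesis
      using Cons by (cases i) auto
  next
    case False
    then have "\<not> P z" if "z \<in> set (y # ys)" for z
      using that Cons.prems(1) down[of y z] by auto
    then show ?thesis
      using nth_mem[OF Cons.prems(2)] by (auto simp: filter_empty_conv)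
  qed
qed simp

text \<open>Sorting preserves the number of estimates satisfying \<open>P\<close>. The instances
  needed are \<open>\<le> \<theta>\<close> for the lower endpoint and \<open>< \<theta>\<close> for
  the upper one.\<close>

lemma order_statistic_iff:
  assumes k: "1 \<le> k" "k \<le> int B" and down: "\<And>x y. x \<le> y \<Longrightarrow> P y \<Longrightarrow> P x"
  shows "P (order_statistic B x k) \<longleftrightarrow> k \<le> int (card {j \<in> {1..B}. P (x j)})"
proof -
  have "card {j \<in> {1..B}. P (x j)} = card (set (filter (P \<circ> x) [1..<Suc B]))"
    by (intro arg_cong[where f = card]) auto
  also have "\<dots> = length (filter P (sort (map x [1..<Suc B])))"
    by (subst distinct_card) (simp_all add: filter_sort filter_map del: upt_Suc)
  finally have "card {j \<in> {1..B}. P (x j)} = length (filter P (sort (map x [1..<Suc B])))" .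
  moreover have "P (order_statistic B x k) \<longleftrightarrow>
      nat (k - 1) < length (filter P (sort (map x [1..<Suc B])))"
    unfolding order_statistic_def using k
    by (intro sorted_nth_iff_filter[OF _ _ down]) (simp_all del: upt_Suc)
  moreover have "nat (k - 1) < n \<longleftrightarrow> k \<le> int n" for n
    using k by linarith
  ultimately show ?thesis
    by (simp only:)
qed

text \<open>This makes the two interval indices mirror images: if the lower one is \<open>l\<close>,
  the upper one is \<open>B + 1 - l\<close>.\<close>

lemma floor_add_ceiling_half: "\<lfloor>real n / 2\<rfloor> + \<lceil>real n / 2\<rceil> = int n"
proof (cases "even n")
  case True
  then obtain m where "n = 2 * m"
    by (rule evenE)
  then show ?thesis
    by simp
next
  case False
  then obtain m where n: "n = 2 * m + 1"
    by (rule oddE)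
  have "\<lfloor>real n / 2\<rfloor> = int m"
    by (rule floor_unique) (simp_all add: n)
  moreover have "\<lceil>real n / 2\<rceil> = int m + 1"
    by (rule ceiling_unique) (simp_all add: n)
  ultimately show ?thesis
    by (simp add: n)
qed

text \<open>A point lies left of the interval when fewer than \<open>l\<close> estimates are at most
  \<open>\<theta>\<close>, and right of it when at least \<open>B + 1 - l\<close> are below
  \<open>\<theta>\<close>. The assumption \<open>1 \<le> l\<close> keeps both indices in range when
  the interval is not empty by convention.\<close>

lemma not_in_ghulc_ci_iff:
  assumes "1 \<le> \<lfloor>real B / 2\<rfloor> - ghulc_c_star B \<alpha> (U \<omega>)"
  shows "\<theta> \<notin> ghulc_ci \<A> W S B U \<alpha> \<omega> \<longleftrightarrow>
    misses {1..B} (\<lfloor>real B / 2\<rfloor> - ghulc_c_star B \<alpha> (U \<omega>)) \<theta> (\<lambda>j. batch_estimator \<A> W S j \<omega>)"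
proof -
  define l where "l = \<lfloor>real B / 2\<rfloor> - ghulc_c_star B \<alpha> (U \<omega>)"
  let ?x = "\<lambda>j. batch_estimator \<A> W S j \<omega>"
  have u: "\<lceil>real B / 2\<rceil> + ghulc_c_star B \<alpha> (U \<omega>) + 1 = int B + 1 - l"
    using floor_add_ceiling_half[of B] by (simp add: l_def)
  have ci: "ghulc_ci \<A> W S B U \<alpha> \<omega> = (if l > int B + 1 - l then {}
      else {order_statistic B ?x l..order_statistic B ?x (int B + 1 - l)})"
    unfolding ghulc_ci_def Let_def u by (simp add: l_def)
  show ?thesis
  proof (cases "l > int B + 1 - l")
    case True
    then show ?thesis
      unfolding ci l_def[symmetric] by (simp add: misses_def)
  next
    case False
    then have l: "1 \<le> l" "l \<le> int B" "1 \<le> int B + 1 - l" "int B + 1 - l \<le> int B"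
      using assms by (auto simp: l_def)
    have "order_statistic B ?x l \<le> \<theta> \<longleftrightarrow> l \<le> int (card {j \<in> {1..B}. ?x j \<le> \<theta>})"
      using l by (intro order_statistic_iff) auto
    moreover have "order_statistic B ?x (int B + 1 - l) < \<theta> \<longleftrightarrow>
        int B + 1 - l \<le> int (card {j \<in> {1..B}. ?x j < \<theta>})"
      using l by (intro order_statistic_iff) auto
    ultimately show ?thesis
      unfolding ci l_def[symmetric] using False by (auto simp: misses_def not_le)
  qed
qed

section \<open>Fair binomial tails and the constants of the procedure\<close>

definition lower_tail :: "nat \<Rightarrow> int \<Rightarrow> real" where
  "lower_tail n l = measure_pmf.prob (binomial_pmf n (1/2)) {k. int k < l}"

lemma lower_tail_mono: "l \<le> m \<Longrightarrow> lower_tail n l \<le> lower_tail n m"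
  unfolding lower_tail_def by (intro measure_pmf.finite_measure_mono) auto

lemma prob_ge_eq_lower_tail:
  "measure_pmf.prob (binomial_pmf n (1/2)) {k. l \<le> int k} = 1 - lower_tail n l"
proof -
  have "{k. l \<le> int k} = UNIV - {k. int k < l}"
    by auto
  then show ?thesis
    by (simp add: lower_tail_def measure_pmf.prob_compl[of "{k. int k < l}", simplified])
qed

text \<open>Complementation is a bijection between the large and the small subsets of an
  \<open>n\<close>-element set.\<close>

lemma lower_tail_symmetric:
  "measure_pmf.prob (binomial_pmf n (1/2)) {k. int n - l < int k} = lower_tail n l"
proof -
  let ?J = "{..<n}"
  have "bij_betw (\<lambda>T. ?J - T) {T \<in> Pow ?J. int n - l < int (card T)} {T \<in> Pow ?J. int (card T) < l}"
  proof (rule bij_betw_byWitness[where f' = "\<lambda>T. ?J - T"])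
    have card: "int (card (?J - T)) = int n - int (card T)" if "T \<subseteq> ?J" for T
      using that card_mono[OF _ that] by (simp add: card_Diff_subset finite_subset of_nat_diff)
    show "(\<lambda>T. ?J - T) ` {T \<in> Pow ?J. int n - l < int (card T)} \<subseteq> {T \<in> Pow ?J. int (card T) < l}"
      "(\<lambda>T. ?J - T) ` {T \<in> Pow ?J. int (card T) < l} \<subseteq> {T \<in> Pow ?J. int n - l < int (card T)}"
      using card by auto
  qed auto
  then have "card {T \<in> Pow ?J. int n - l < int (card T)} = card {T \<in> Pow ?J. int (card T) < l}"
    by (rule bij_betw_same_card)
  then show ?thesis
    using binomial_half_eq_pmf_of_set[of ?J]
    by (simp add: lower_tail_def measure_pmf_of_set card_Pow Pow_not_empty Int_def vimage_def)
qed

text \<open>The assumption says precisely that the two tails are disjoint; by symmetry they have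
  equal mass.\<close>

lemma tail_prob_eq_lower_tail:
  assumes "2 * l \<le> int n + 1"
  shows "tail_prob n l = 2 * lower_tail n l"
proof -
  have "{k. in_tails n l k} = {k. int k < l} \<union> {k. int n - l < int k}"
    by (auto simp: in_tails_def)
  moreover have "{k. int k < l} \<inter> {k. int n - l < int k} = {}"
    using assms by auto
  ultimately show ?thesis
    using measure_pmf.finite_measure_Union[of "{k. int k < l}" "binomial_pmf n (1/2)" "{k. int n - l < int k}"]
    by (simp add: tail_prob_def lower_tail_symmetric flip: lower_tail_def)
qed

lemma tail_prob_eq_1:
  assumes "int n + 1 < 2 * l"
  shows "tail_prob n l = 1"
proof -
  have "{k. in_tails n l k} = UNIV"
    using assms by (auto simp: in_tails_def)
  then show ?thesis
    by (simp add: tail_prob_def)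
qed

text \<open>The summation range from \<open>l\<close> to \<open>n - l\<close> is the complement of
  the tails, so \<open>ghulc_tau\<close> can be expressed through \<open>tail_prob\<close>.\<close>

lemma central_binomial_prob_eq:
  "central_binomial_prob n c = 1 - tail_prob n (\<lfloor>real n / 2\<rfloor> - c)"
proof -
  define l where "l = \<lfloor>real n / 2\<rfloor> - c"
  have u: "\<lceil>real n / 2\<rceil> + c = int n - l"
    using floor_add_ceiling_half[of n] by (simp add: l_def)
  let ?K = "{k. l \<le> int k \<and> int k \<le> int n - l}"
  have "?K \<subseteq> {..nat (int n - l)}"
    by auto
  then have fin: "finite ?K"
    by (rule finite_subset) simp
  have pmf: "pmf (binomial_pmf n (1/2)) k = real (n choose k) / 2 ^ n" for k
  proof (cases "k \<le> n")
    case True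
    then have "(1/2) ^ k * (1 - 1/2) ^ (n - k) = (1 / 2 ^ n :: real)"
      by (simp add: power_one_over flip: power_add)
    then show ?thesis
      by (simp add: mult.assoc)
  qed (simp add: binomial_eq_0)
  have "central_binomial_prob n c = (\<Sum>i\<in>{l..int n - l}. if i < 0 then 0 else real (n choose nat i) / 2 ^ n)"
    by (simp add: central_binomial_prob_def u l_def[symmetric])
  \<comment> \<open>Only negative indices are dropped, and these contribute 0; indices above
    \<open>n\<close> stay and vanish through the binomial coefficient.\<close>
  also have "\<dots> = (\<Sum>i\<in>int ` ?K. if i < 0 then 0 else real (n choose nat i) / 2 ^ n)"
  proof (rule sum.mono_neutral_right)
    show "\<forall>i\<in>{l..int n - l} - int ` ?K. (if i < 0 then 0 else real (n choose nat i) / 2 ^ n) = 0"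
    proof
      fix i assume i: "i \<in> {l..int n - l} - int ` ?K"
      have "i < 0"
      proof (rule ccontr)
        assume "\<not> i < 0"
        then have "i = int (nat i)"
          by simp
        then show False
          using i by (metis (mono_tags, lifting) DiffE atLeastAtMost_iff image_eqI mem_Collect_eq)
      qed
      then show "(if i < 0 then 0 else real (n choose nat i) / 2 ^ n) = 0"
        by simp
    qed
  qed auto
  also have "\<dots> = (\<Sum>k\<in>?K. pmf (binomial_pmf n (1/2)) k)"
    by (subst sum.reindex) (simp_all add: pmf)
  also have "\<dots> = measure_pmf.prob (binomial_pmf n (1/2)) ?K"
    using fin by (simp add: measure_measure_pmf_finite)
  also have "?K = UNIV - {k. in_tails n l k}"
    by (auto simp: in_tails_def)
  also have "measure_pmf.prob (binomial_pmf n (1/2)) \<dots> = 1 - tail_prob n l"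
    by (simp add: tail_prob_def measure_pmf.prob_compl[of "{k. in_tails n l k}", simplified])
  finally show ?thesis
    by (simp add: l_def)
qed

text \<open>By symmetry the complementary upper tail equals a lower tail with cut-off
  \<open>n - \<lfloor>real n / 2\<rfloor>\<close>, which is at most
  \<open>\<lfloor>real n / 2\<rfloor> + 1\<close>.\<close>

lemma lower_tail_half:
  "1 / 2 \<le> lower_tail n (\<lfloor>real n / 2\<rfloor> + 1)"
proof -
  let ?f = "\<lfloor>real n / 2\<rfloor>"
  have "1 - lower_tail n (?f + 1) = lower_tail n (int n - ?f)"
    using prob_ge_eq_lower_tail[of n "?f + 1"] lower_tail_symmetric[of n "int n - ?f"]
    by (simp add: zless_imp_add1_zle add1_zle_eq)
  also have "\<dots> \<le> lower_tail n (?f + 1)"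
    by (rule lower_tail_mono) linarith
  finally show ?thesis
    by simp
qed

lemma lower_tail_1: "lower_tail n 1 = 1 / 2 ^ n"
proof -
  have "{k. int k < 1} = {0}"
    by auto
  then show ?thesis
    by (simp add: lower_tail_def measure_pmf_single power_one_over)
qed

text \<open>The condition on the number of batches in terms of \<open>lower_tail B 1\<close>, the
  probability that fair coins show no head.\<close>

lemma two_power_ge:
  assumes "0 < \<alpha>" "log 2 (2 / \<alpha>) \<le> real B"
  shows "1 / 2 ^ B \<le> \<alpha> / 2"
proof -
  have "2 / \<alpha> \<le> 2 ^ B"
    using assms by (simp add: log_le_iff powr_realpow)
  then show ?thesis
    using assms by (simp add: field_simps)
qed

text \<open>Minimality of \<open>ghulc_c\<close> makes \<open>l\<close> the largest index whose
  lower fair-coin tail is at most \<open>\<alpha> / 2\<close>; doubling then brackets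
  \<open>\<alpha>\<close> between the tail probabilities at \<open>l\<close> and
  \<open>l + 1\<close>.\<close>

lemma ghulc_c_properties:
  assumes \<alpha>: "0 < \<alpha>" "\<alpha> < 1" and B: "log 2 (2 / \<alpha>) \<le> real B"
  defines "l \<equiv> \<lfloor>real B / 2\<rfloor> - ghulc_c B \<alpha>"
  shows "1 \<le> l" "tail_prob B l \<le> \<alpha>" "\<alpha> < tail_prob B (l + 1)"
proof -
  let ?f = "\<lfloor>real B / 2\<rfloor>"
  define Q where "Q x \<longleftrightarrow> lower_tail B (?f - x) \<le> \<alpha> / 2" for x
  \<comment> \<open>The minimum in \<open>ghulc_c\<close> ranges over all integers, so a lower bound
    is needed for it to exist: for negative \<open>x\<close> the lower tail is at least
    \<open>1/2\<close>, which exceeds \<open>\<alpha> / 2\<close>.\<close>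
  have nonneg: "0 \<le> x" if "Q x" for x
  proof (rule ccontr)
    assume "\<not> 0 \<le> x"
    then have "lower_tail B (?f + 1) \<le> lower_tail B (?f - x)"
      by (intro lower_tail_mono) simp
    then show False
      using that lower_tail_half[of B] \<alpha> by (simp add: Q_def)
  qed
  \<comment> \<open>This \<open>x\<close> corresponds to the index 1, where the lower tail is
    \<open>1 / 2 ^ B\<close>.\<close>
  have start: "Q (?f - 1)"
    using two_power_ge[OF \<alpha>(1) B] by (simp add: Q_def lower_tail_1)
  define m where "m = (LEAST n. Q (int n))"
  have Q_m: "Q (int m)"
    unfolding m_def using start nonneg[OF start] by (intro LeastI[of "\<lambda>n. Q (int n)" "nat (?f - 1)"]) simp
  have m_le: "int m \<le> x" if "Q x" for x
    using that nonneg[OF that] Least_le[of "\<lambda>n. Q (int n)" "nat x"] by (simp add: m_def)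
  have "ghulc_c B \<alpha> = (LEAST x. Q x)"
    unfolding ghulc_c_def Q_def prob_ge_eq_lower_tail by simp
  also have "\<dots> = int m"
    using Q_m m_le by (rule Least_equality)
  finally have l: "l = ?f - int m"
    by (simp add: l_def)
  show "1 \<le> l"
    using m_le[OF start] by (simp add: l)
  have "real_of_int (2 * ?f) \<le> real_of_int (int B)"
    using of_int_floor_le[of "real B / 2"] by simp
  then have f: "2 * ?f \<le> int B"
    by (rule of_int_le_iff[THEN iffD1])
  have "l \<le> ?f"
    unfolding l by simp
  then have "2 * l \<le> 2 * ?f"
    by (intro mult_left_mono) simp_all
  also note f
  finally have "2 * l \<le> int B + 1"
    by (rule add_increasing2[rotated]) simp
  then show "tail_prob B l \<le> \<alpha>"
    using Q_m by (simp add: tail_prob_eq_lower_tail Q_def l)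
  have "\<not> Q (int m - 1)"
    using m_le[of "int m - 1"] by auto
  then have "\<alpha> < 2 * lower_tail B (l + 1)"
    by (simp add: Q_def l algebra_simps)
  then show "\<alpha> < tail_prob B (l + 1)"
    \<comment> \<open>If the tails at \<open>l + 1\<close> overlap, which happens only for even
      \<open>B\<close> and \<open>m = 0\<close>, their union has probability 1 and
      \<open>\<alpha> < 1\<close> suffices.\<close>
    using \<alpha> by (cases "2 * (l + 1) \<le> int B + 1") (simp_all add: tail_prob_eq_lower_tail tail_prob_eq_1)
qed

text \<open>Rewritten with tail probabilities, \<open>ghulc_tau\<close> is the weight that mixes
  those at \<open>l + 1\<close> and \<open>l\<close> to exactly \<open>\<alpha>\<close>; the
  bracketing of \<open>\<alpha>\<close> makes it well defined and places it in the unit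
  interval.\<close>

lemma ghulc_tau_properties:
  assumes \<alpha>: "0 < \<alpha>" "\<alpha> < 1" and B: "log 2 (2 / \<alpha>) \<le> real B"
  defines "l \<equiv> \<lfloor>real B / 2\<rfloor> - ghulc_c B \<alpha>"
  shows "0 \<le> ghulc_tau B \<alpha>" "ghulc_tau B \<alpha> < 1"
    and "ghulc_tau B \<alpha> * tail_prob B (l + 1) + (1 - ghulc_tau B \<alpha>) * tail_prob B l = \<alpha>"
proof -
  define \<tau> where "\<tau> = ghulc_tau B \<alpha>"
  note l = ghulc_c_properties[OF \<alpha> B, folded l_def]
  have l': "\<lfloor>real B / 2\<rfloor> - (ghulc_c B \<alpha> - 1) = l + 1"
    by (simp add: l_def)
  have \<tau>: "\<tau> = (\<alpha> - tail_prob B l) / (tail_prob B (l + 1) - tail_prob B l)"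
    unfolding \<tau>_def ghulc_tau_def central_binomial_prob_eq l' l_def[symmetric] by simp
  have "\<tau> * (tail_prob B (l + 1) - tail_prob B l) = \<alpha> - tail_prob B l"
    using l by (simp add: \<tau>)
  then show "ghulc_tau B \<alpha> * tail_prob B (l + 1) + (1 - ghulc_tau B \<alpha>) * tail_prob B l = \<alpha>"
    by (simp add: \<tau>_def algebra_simps)
  show "0 \<le> ghulc_tau B \<alpha>" "ghulc_tau B \<alpha> < 1"
    unfolding \<tau>_def[symmetric] \<tau> using l by (simp_all add: divide_simps)
qed

section \<open>Miscoverage of the interval\<close>

context ghulc_setup
begin

lemma batch:
  assumes "j \<in> {1..B}"
  shows "finite (S j)" "S j \<subseteq> {1..N}"
proof -
  show "S j \<subseteq> {1..N}"
    using split_union assms by blast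
  then show "finite (S j)"
    by (rule finite_subset) simp
qed

text \<open>The assumption on \<open>\<A>\<close> concerns index sets \<open>{..<n}\<close> only;
  relabelling coordinates by their position in \<open>L\<close> transfers it to
  \<open>K\<close>.\<close>

lemma measurable_procedure:
  assumes "set L \<subseteq> K"
  shows "(\<lambda>x. \<A> (map x L)) \<in> borel_measurable (\<Pi>\<^sub>M i\<in>K. E)"
proof -
  let ?n = "length L"
  have "(\<lambda>x. \<lambda>i\<in>{..<?n}. x (L ! i)) \<in> measurable (\<Pi>\<^sub>M i\<in>K. E) (\<Pi>\<^sub>M i\<in>{..<?n}. E)"
    using assms by (intro measurable_restrict measurable_component_singleton) auto
  moreover have "(\<lambda>x. \<A> (map x [0..<?n])) \<in> borel_measurable (\<Pi>\<^sub>M i\<in>{..<?n}. E)"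
    using procedure by (simp add: estimation_procedure_def)
  ultimately have "(\<lambda>x. \<A> (map (\<lambda>i\<in>{..<?n}. x (L ! i)) [0..<?n])) \<in> borel_measurable (\<Pi>\<^sub>M i\<in>K. E)"
    by (rule measurable_compose)
  moreover have eq: "map (\<lambda>i\<in>{..<?n}. x (L ! i)) [0..<?n] = map x L" for x
    by (rule nth_equalityI) auto
  ultimately show ?thesis
    by (simp only: eq)
qed

text \<open>Taken with \<open>K = S j\<close> for independence between batches, and with
  \<open>K = {1..N}\<close> for independence from \<open>U\<close>.\<close>

lemma batch_estimator_eq_restrict:
  assumes "j \<in> {1..B}" "S j \<subseteq> K"
  shows "batch_estimator \<A> W S j \<omega> = \<A> (map (\<lambda>i\<in>K. W i \<omega>) (sorted_list_of_set (S j)))"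
  unfolding batch_estimator_def using batch[OF assms(1)] assms(2)
  by (intro arg_cong[where f = \<A>] map_cong) auto

text \<open>Each estimator is a measurable function of its own batch, and disjoint batches of
  independent observations are independent.\<close>

lemma indep_batch_estimators: "indep_vars (\<lambda>_. borel) (batch_estimator \<A> W S) {1..B}"
proof -
  have "indep_vars (\<lambda>j. \<Pi>\<^sub>M i\<in>S j. E) (\<lambda>j \<omega>. \<lambda>i\<in>S j. W i \<omega>) {1..B}"
    using indep_observations batch(2) split_disjoint by (rule indep_vars_restrict)
  then have "indep_vars (\<lambda>_. borel)
      (\<lambda>j \<omega>. \<A> (map (\<lambda>i\<in>S j. W i \<omega>) (sorted_list_of_set (S j)))) {1..B}"
    by (rule indep_vars_compose2[where Y = "\<lambda>j x. \<A> (map x (sorted_list_of_set (S j)))"])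
      (simp add: measurable_procedure batch(1))
  then show ?thesis
    by (rule indep_vars_cong[THEN iffD1, rotated -1])
      (auto simp: batch_estimator_eq_restrict[OF _ subset_refl] fun_eq_iff)
qed

text \<open>A miss is the preimage of a measurable set \<open>D\<close> under the whole data vector,
  so \<open>U_indep\<close> applies.\<close>

lemma prob_U_and_misses:
  assumes C: "C \<in> sets borel"
  shows "\<P>(\<omega> in M. U \<omega> \<in> C \<and> misses {1..B} l \<theta> (\<lambda>j. batch_estimator \<A> W S j \<omega>)) =
    \<P>(\<omega> in M. U \<omega> \<in> C) * \<P>(\<omega> in M. misses {1..B} l \<theta> (\<lambda>j. batch_estimator \<A> W S j \<omega>))"
proof -
  let ?P = "\<Pi>\<^sub>M i\<in>{1..N}. E"
  let ?V = "\<lambda>\<omega>. \<lambda>i\<in>{1..N}. W i \<omega>"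
  define D where "D = {x \<in> space ?P. misses {1..B} l \<theta> (\<lambda>j. \<A> (map x (sorted_list_of_set (S j))))}"
  have "Measurable.pred ?P (\<lambda>x. misses {1..B} l \<theta> (\<lambda>j. \<A> (map x (sorted_list_of_set (S j)))))"
    using batch by (intro measurable_misses measurable_procedure) auto
  then have D: "D \<in> sets ?P"
    unfolding D_def by (rule predE)
  have "?V \<in> measurable M ?P"
    using indep_observations by (intro measurable_restrict) (auto simp: indep_vars_def)
  then have V: "?V \<omega> \<in> space ?P" if "\<omega> \<in> space M" for \<omega>
    using that by (rule measurable_space)
  have misses: "misses {1..B} l \<theta> (\<lambda>j. batch_estimator \<A> W S j \<omega>) \<longleftrightarrow>
      misses {1..B} l \<theta> (\<lambda>j. \<A> (map (?V \<omega>) (sorted_list_of_set (S j))))" for \<omega>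
    using batch(2) by (intro misses_cong batch_estimator_eq_restrict) auto
  have eq: "{\<omega> \<in> space M. misses {1..B} l \<theta> (\<lambda>j. batch_estimator \<A> W S j \<omega>)} = ?V -` D \<inter> space M"
    using V unfolding misses by (auto simp: D_def)
  have indep: "prob ((U -` C \<inter> space M) \<inter> (?V -` D \<inter> space M)) = prob (U -` C \<inter> space M) * prob (?V -` D \<inter> space M)"
    using C D by (intro indep_setD[OF U_indep]) auto
  have eq1: "(U -` C \<inter> space M) \<inter> (?V -` D \<inter> space M) =
      {\<omega> \<in> space M. U \<omega> \<in> C \<and> misses {1..B} l \<theta> (\<lambda>j. batch_estimator \<A> W S j \<omega>)}"
    using eq by auto
  have eq2: "U -` C \<inter> space M = {\<omega> \<in> space M. U \<omega> \<in> C}"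
    by auto
  show ?thesis
    using indep unfolding eq1 unfolding eq2 eq .
qed

lemma prob_U_le:
  assumes "0 \<le> \<tau>" "\<tau> < 1"
  shows "\<P>(\<omega> in M. U \<omega> \<in> {..\<tau>}) = \<tau>" "\<P>(\<omega> in M. U \<omega> \<in> {\<tau><..}) = 1 - \<tau>"
proof -
  have "\<P>(\<omega> in M. U \<omega> \<in> {..\<tau>}) = measure (distr M borel U) {..\<tau>}"
    using U_measurable by (simp add: measure_distr vimage_def Int_def conj_commute)
  also have "\<dots> = measure lborel ({0<..<1} \<inter> {..\<tau>})"
    unfolding U_uniform by (subst measure_uniform_measure) auto
  also have "{0<..<1} \<inter> {..\<tau>} = {0<..\<tau>}"
    using assms by auto
  finally show 1: "\<P>(\<omega> in M. U \<omega> \<in> {..\<tau>}) = \<tau>"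
    using assms by simp
  have "\<P>(\<omega> in M. \<not> U \<omega> \<in> {..\<tau>}) = 1 - \<P>(\<omega> in M. U \<omega> \<in> {..\<tau>})"
    using U_measurable by (intro prob_neg) measurable
  then show "\<P>(\<omega> in M. U \<omega> \<in> {\<tau><..}) = 1 - \<tau>"
    by (simp add: 1[simplified] not_le)
qed

text \<open>On \<open>U \<le> \<tau>\<close> the constant drops by one, which raises the lower index
  from \<open>l\<close> to \<open>l + 1\<close>. The two cases are disjoint, and \<open>U\<close> is
  independent of the misses.\<close>

lemma ghulc_miscoverage_eq:
  assumes \<alpha>: "0 < \<alpha>" "\<alpha> < 1"
  defines "l \<equiv> \<lfloor>real B / 2\<rfloor> - ghulc_c B \<alpha>"
  shows "ghulc_miscoverage M \<A> W S B U \<alpha> \<theta> =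
    ghulc_tau B \<alpha> * \<P>(\<omega> in M. misses {1..B} (l + 1) \<theta> (\<lambda>j. batch_estimator \<A> W S j \<omega>)) +
    (1 - ghulc_tau B \<alpha>) * \<P>(\<omega> in M. misses {1..B} l \<theta> (\<lambda>j. batch_estimator \<A> W S j \<omega>))"
proof -
  define \<tau> where "\<tau> = ghulc_tau B \<alpha>"
  define miss where "miss m \<omega> = misses {1..B} m \<theta> (\<lambda>j. batch_estimator \<A> W S j \<omega>)" for m \<omega>
  have \<tau>: "0 \<le> \<tau>" "\<tau> < 1"
    using ghulc_tau_properties(1,2)[OF \<alpha> batches] by (simp_all add: \<tau>_def)
  have l: "1 \<le> l"
    using ghulc_c_properties(1)[OF \<alpha> batches] by (simp add: l_def)
  have [measurable]: "U \<in> borel_measurable M"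
    by (rule U_measurable)
  have [measurable]: "Measurable.pred M (miss m)" for m
    using indep_batch_estimators unfolding miss_def
    by (intro measurable_misses) (auto simp: indep_vars_def)
  have iff: "\<theta> \<notin> ghulc_ci \<A> W S B U \<alpha> \<omega> \<longleftrightarrow>
      U \<omega> \<in> {..\<tau>} \<and> miss (l + 1) \<omega> \<or> U \<omega> \<in> {\<tau><..} \<and> miss l \<omega>" for \<omega>
  proof -
    have *: "\<lfloor>real B / 2\<rfloor> - ghulc_c_star B \<alpha> (U \<omega>) = (if U \<omega> \<le> \<tau> then l + 1 else l)"
      by (simp add: ghulc_c_star_def \<tau>_def l_def)
    show ?thesis
      using not_in_ghulc_ci_iff[of B \<alpha> U \<omega> \<theta> \<A> W S] l unfolding * by (auto simp: not_le miss_def)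
  qed
  have "ghulc_miscoverage M \<A> W S B U \<alpha> \<theta> =
      prob ({\<omega> \<in> space M. U \<omega> \<in> {..\<tau>} \<and> miss (l + 1) \<omega>} \<union> {\<omega> \<in> space M. U \<omega> \<in> {\<tau><..} \<and> miss l \<omega>})"
    unfolding ghulc_miscoverage_def iff by (intro arg_cong[where f = prob]) blast
  also have "\<dots> = \<P>(\<omega> in M. U \<omega> \<in> {..\<tau>} \<and> miss (l + 1) \<omega>) + \<P>(\<omega> in M. U \<omega> \<in> {\<tau><..} \<and> miss l \<omega>)"
    by (intro finite_measure_Union) auto
  also have "\<dots> = \<tau> * \<P>(\<omega> in M. miss (l + 1) \<omega>) + (1 - \<tau>) * \<P>(\<omega> in M. miss l \<omega>)"
    unfolding miss_def
    by (subst (1 2) prob_U_and_misses) (simp_all only: prob_U_le[OF \<tau>] greaterThan_borel atMost_borel)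
  finally show ?thesis
    by (simp only: \<tau>_def miss_def)
qed

text \<open>These are the conditions on \<open>e\<close> in \<open>prob_misses_le\<close>. The
  positive part gives the lower bound, nonnegativity of probabilities the upper one, and
  \<open>0 < B\<close> makes the maximum range over a nonempty set.\<close>

lemma max_median_bias_properties:
  fixes \<theta> :: real
  assumes "0 < B"
  defines "\<E> \<equiv> max_median_bias M \<A> W S B \<theta>"
  shows "0 \<le> \<E>" "\<E> \<le> 1/2"
    and "\<And>j. j \<in> {1..B} \<Longrightarrow> 1/2 - \<E> \<le> \<P>(\<omega> in M. batch_estimator \<A> W S j \<omega> \<le> \<theta>)"
    and "\<And>j. j \<in> {1..B} \<Longrightarrow> 1/2 - \<E> \<le> \<P>(\<omega> in M. \<theta> \<le> batch_estimator \<A> W S j \<omega>)"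
proof -
  define b where "b j = max (1/2 - min \<P>(\<omega> in M. batch_estimator \<A> W S j \<omega> \<ge> \<theta>)
    \<P>(\<omega> in M. batch_estimator \<A> W S j \<omega> \<le> \<theta>)) 0" for j
  have \<E>: "\<E> = Max (b ` {1..B})"
    by (simp add: \<E>_def max_median_bias_def b_def)
  have b_le: "b j \<le> \<E>" if "j \<in> {1..B}" for j
    unfolding \<E> using that by (intro Max_ge) auto
  have "\<E> \<in> b ` {1..B}"
    unfolding \<E> using assms(1) by (intro Max_in) auto
  moreover have "0 \<le> b j" "b j \<le> 1/2" for j
    unfolding b_def by (intro max.boundedI max.cobounded2; simp add: min_def)+
  ultimately show "0 \<le> \<E>" "\<E> \<le> 1/2"
    by auto
  show "1/2 - \<E> \<le> \<P>(\<omega> in M. batch_estimator \<A> W S j \<omega> \<le> \<theta>)"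
    "1/2 - \<E> \<le> \<P>(\<omega> in M. \<theta> \<le> batch_estimator \<A> W S j \<omega>)" if "j \<in> {1..B}" for j
    using b_le[OF that] unfolding b_def by linarith+
qed

text \<open>The bounds at \<open>l\<close> and \<open>l + 1\<close> share the same factor, and the
  tail probabilities in front of it mix to \<open>\<alpha>\<close>.\<close>

lemma ghulc_miscoverage_le:
  fixes \<theta> :: real
  assumes \<alpha>: "0 < \<alpha>" "\<alpha> < 1"
  defines "\<E> \<equiv> max_median_bias M \<A> W S B \<theta>"
  shows "ghulc_miscoverage M \<A> W S B U \<alpha> \<theta>
    \<le> \<alpha> * (1 + 2 * (real B)\<^sup>2 * \<E>\<^sup>2 * exp (2 * real B * \<E>))"
proof -
  define l where "l = \<lfloor>real B / 2\<rfloor> - ghulc_c B \<alpha>"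
  let ?R = "1 + 2 * (real B)\<^sup>2 * \<E>\<^sup>2 * exp (2 * real B * \<E>)"
  note \<tau> = ghulc_tau_properties[OF \<alpha> batches, folded l_def]
  \<comment> \<open>For \<open>B = 0\<close> the bound \<open>two_power_ge\<close> would read
    \<open>1 \<le> \<alpha> / 2\<close>.\<close>
  have "0 < B"
    using two_power_ge[OF \<alpha>(1) batches] \<alpha> by (cases B) auto
  note \<E> = max_median_bias_properties[OF this, where \<theta> = \<theta>, folded \<E>_def]
  have miss: "\<P>(\<omega> in M. misses {1..B} m \<theta> (\<lambda>j. batch_estimator \<A> W S j \<omega>)) \<le> tail_prob B m * ?R" for m
    using prob_misses_le[OF finite_atLeastAtMost indep_batch_estimators \<E>] by simp
  have "ghulc_miscoverage M \<A> W S B U \<alpha> \<theta>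
      \<le> ghulc_tau B \<alpha> * (tail_prob B (l + 1) * ?R) + (1 - ghulc_tau B \<alpha>) * (tail_prob B l * ?R)"
    unfolding ghulc_miscoverage_eq[OF \<alpha>] l_def[symmetric]
    using \<tau>(1,2) by (intro add_mono mult_left_mono miss) auto
  also have "\<dots> = (ghulc_tau B \<alpha> * tail_prob B (l + 1) + (1 - ghulc_tau B \<alpha>) * tail_prob B l) * ?R"
    by (simp only: distrib_right mult.assoc)
  finally show ?thesis
    unfolding \<tau>(3) .
qed

lemma ghulc_miscoverage_ge:
  assumes \<alpha>: "0 < \<alpha>" "\<alpha> < 1"
    and same: "\<And>j. j \<in> {1..B} \<Longrightarrow> \<P>(\<omega> in M. batch_estimator \<A> W S j \<omega> \<le> \<theta>) = p"
    and ties: "\<And>j. j \<in> {1..B} \<Longrightarrow> \<P>(\<omega> in M. batch_estimator \<A> W S j \<omega> = \<theta>) = 0"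
    and p: "0 \<le> p" "p \<le> 1"
  shows "\<alpha> \<le> ghulc_miscoverage M \<A> W S B U \<alpha> \<theta>"
proof -
  define l where "l = \<lfloor>real B / 2\<rfloor> - ghulc_c B \<alpha>"
  note \<tau> = ghulc_tau_properties[OF \<alpha> batches, folded l_def]
  have miss: "tail_prob B m \<le> \<P>(\<omega> in M. misses {1..B} m \<theta> (\<lambda>j. batch_estimator \<A> W S j \<omega>))" for m
    using prob_misses_ge[OF finite_atLeastAtMost indep_batch_estimators same p ties] by simp
  have "\<alpha> = ghulc_tau B \<alpha> * tail_prob B (l + 1) + (1 - ghulc_tau B \<alpha>) * tail_prob B l"
    by (rule \<tau>(3)[symmetric])
  also have "\<dots> \<le> ghulc_miscoverage M \<A> W S B U \<alpha> \<theta>"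
    unfolding ghulc_miscoverage_eq[OF \<alpha>] l_def[symmetric]
    using \<tau>(1,2) by (intro add_mono mult_left_mono miss) auto
  finally show ?thesis .
qed

end

text \<open>The finite-sample bound is a continuous function of the product of batch number and
  bias, with value \<open>\<alpha>\<close> at 0.\<close>

lemma limsup_ghulc_miscoverage_le:
  assumes \<alpha>: "0 < \<alpha>" "\<alpha> < 1"
    and ghulc: "\<And>N. 1 \<le> N \<Longrightarrow> ghulc_setup (M N) (E N) (W N) N (\<A> N) (S N) (B N) (U N) \<alpha>"
    and lim: "(\<lambda>N. real (B N) * max_median_bias (M N) (\<A> N) (W N) (S N) (B N) \<theta>) \<longlonglongrightarrow> 0"
  shows "limsup (\<lambda>N. ereal (ghulc_miscoverage (M N) (\<A> N) (W N) (S N) (B N) (U N) \<alpha> \<theta>)) \<le> ereal \<alpha>"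
proof -
  define x where "x N = real (B N) * max_median_bias (M N) (\<A> N) (W N) (S N) (B N) \<theta>" for N
  define b where "b N = \<alpha> * (1 + 2 * (x N)\<^sup>2 * exp (2 * x N))" for N
  have "x \<longlonglongrightarrow> 0"
    using lim by (simp add: x_def[abs_def])
  then have "b \<longlonglongrightarrow> \<alpha> * (1 + 2 * 0\<^sup>2 * exp (2 * 0))"
    unfolding b_def by (intro tendsto_intros)
  then have b: "(\<lambda>N. ereal (b N)) \<longlonglongrightarrow> ereal \<alpha>"
    by simp
  have "limsup (\<lambda>N. ereal (ghulc_miscoverage (M N) (\<A> N) (W N) (S N) (B N) (U N) \<alpha> \<theta>))
      \<le> limsup (\<lambda>N. ereal (b N))"
  \<comment> \<open>The setup is assumed from \<open>N = 1\<close> on only, so the comparison holds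
    eventually.\<close>
  proof (rule Limsup_mono, rule eventually_mono[OF eventually_ge_at_top[of 1]])
    fix N :: nat assume "1 \<le> N"
    from ghulc_setup.ghulc_miscoverage_le[OF ghulc[OF this] \<alpha>, of \<theta>]
    show "ereal (ghulc_miscoverage (M N) (\<A> N) (W N) (S N) (B N) (U N) \<alpha> \<theta>) \<le> ereal (b N)"
      by (simp add: b_def x_def power_mult_distrib mult.assoc)
  qed
  also have "\<dots> = ereal \<alpha>"
    using b by (intro lim_imp_Limsup) simp_all
  finally show ?thesis .
qed

theorem theorem5:
  fixes \<theta>\<^sub>0 \<alpha> :: real
  assumes "0 < \<alpha>" and "\<alpha> < 1"
  shows
    "(\<forall>(M :: 'a measure) (E :: 'w measure) W N \<A> S B U.
        ghulc_setup M E W N \<A> S B U \<alpha> \<longrightarrow>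
          (let \<E> = max_median_bias M \<A> W S B \<theta>\<^sub>0
           in ghulc_miscoverage M \<A> W S B U \<alpha> \<theta>\<^sub>0
                \<le> \<alpha> * (1 + 2 * (real B)\<^sup>2 * \<E>\<^sup>2 * exp (2 * real B * \<E>))))
     \<and> (\<forall>(M :: nat \<Rightarrow> 'a measure) (E :: nat \<Rightarrow> 'w measure) W \<A> S B U.
        (\<forall>N\<ge>1. ghulc_setup (M N) (E N) (W N) N (\<A> N) (S N) (B N) (U N) \<alpha>) \<longrightarrow>
        (\<lambda>N. real (B N) * max_median_bias (M N) (\<A> N) (W N) (S N) (B N) \<theta>\<^sub>0) \<longlonglongrightarrow> 0 \<longrightarrow>
          limsup (\<lambda>N. ereal (ghulc_miscoverage (M N) (\<A> N) (W N) (S N) (B N) (U N) \<alpha> \<theta>\<^sub>0)) \<le> ereal \<alpha>)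
     \<and> (\<forall>(M :: 'a measure) (E :: 'w measure) W N \<A> S B U.
        ghulc_setup M E W N \<A> S B U \<alpha> \<longrightarrow>
        (\<forall>j\<in>{1..B}.
           \<P>(\<omega> in M. batch_estimator \<A> W S j \<omega> \<le> \<theta>\<^sub>0) = \<P>(\<omega> in M. batch_estimator \<A> W S 1 \<omega> \<le> \<theta>\<^sub>0) \<and>
           \<P>(\<omega> in M. batch_estimator \<A> W S j \<omega> = \<theta>\<^sub>0) = 0) \<longrightarrow>
          ghulc_miscoverage M \<A> W S B U \<alpha> \<theta>\<^sub>0 \<ge> \<alpha>)"
proof (intro conjI allI impI)
  fix M :: "'a measure" and E :: "'w measure" and W N \<A> S B U
  assume "ghulc_setup M E W N \<A> S B U \<alpha>"
  then show "let \<E> = max_median_bias M \<A> W S B \<theta>\<^sub>0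
      in ghulc_miscoverage M \<A> W S B U \<alpha> \<theta>\<^sub>0
        \<le> \<alpha> * (1 + 2 * (real B)\<^sup>2 * \<E>\<^sup>2 * exp (2 * real B * \<E>))"
    unfolding Let_def using assms by (rule ghulc_setup.ghulc_miscoverage_le)
next
  fix M :: "nat \<Rightarrow> 'a measure" and E :: "nat \<Rightarrow> 'w measure" and W \<A> S B U
  assume "\<forall>N\<ge>1. ghulc_setup (M N) (E N) (W N) N (\<A> N) (S N) (B N) (U N) \<alpha>"
    and "(\<lambda>N. real (B N) * max_median_bias (M N) (\<A> N) (W N) (S N) (B N) \<theta>\<^sub>0) \<longlonglongrightarrow> 0"
  then show "limsup (\<lambda>N. ereal (ghulc_miscoverage (M N) (\<A> N) (W N) (S N) (B N) (U N) \<alpha> \<theta>\<^sub>0)) \<le> ereal \<alpha>"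
    using assms by (intro limsup_ghulc_miscoverage_le) auto
next
  fix M :: "'a measure" and E :: "'w measure" and W N \<A> S B U
  assume ghulc: "ghulc_setup M E W N \<A> S B U \<alpha>"
    and *: "\<forall>j\<in>{1..B}.
      \<P>(\<omega> in M. batch_estimator \<A> W S j \<omega> \<le> \<theta>\<^sub>0) = \<P>(\<omega> in M. batch_estimator \<A> W S 1 \<omega> \<le> \<theta>\<^sub>0) \<and>
      \<P>(\<omega> in M. batch_estimator \<A> W S j \<omega> = \<theta>\<^sub>0) = 0"
  interpret ghulc_setup M E W N \<A> S B U \<alpha>
    by (rule ghulc)
  show "ghulc_miscoverage M \<A> W S B U \<alpha> \<theta>\<^sub>0 \<ge> \<alpha>"
  proof (rule ghulc_miscoverage_ge[OF assms])
    show "\<P>(\<omega> in M. batch_estimator \<A> W S j \<omega> \<le> \<theta>\<^sub>0) = \<P>(\<omega> in M. batch_estimator \<A> W S 1 \<omega> \<le> \<theta>\<^sub>0)"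
      "\<P>(\<omega> in M. batch_estimator \<A> W S j \<omega> = \<theta>\<^sub>0) = 0" if "j \<in> {1..B}" for j
      using bspec[OF * that] by blast+
  qed simp_all
qed

end
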